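(* Let $\mathcal{Y}$ be a measurable space with $|\mathcal{Y}|\ge 2$, let $\mathcal{H}$ be the set of all constant functions $\mathbb{R}\to\mathcal{Y}$, and let $k\in\mathbb{N}$. For any $\varepsilon\in(0,1/2)$ there exists an $s$-sample $q$-query $\varepsilon$-tester for $\mathcal{F}_k(\mathcal{H})$ under $\mathrm{Uniform}(0,1)$ with $s=O(\sqrt{k}/\varepsilon^{5})$, and with $q=O(1/\varepsilon^{4})$ for active testing, and $q=s$ for passive testing. Moreover, if $\varepsilon\in(0,1/8)$, every $s$-sample $s$-query $\varepsilon$-tester for $\mathcal{F}_k(\mathcal{H})$ under $\mathrm{Uniform}(0,1)$ has $s=\Omega(\sqrt{k})$. (The $O,\Omega$ hide numerical constants independent of $k$ and $\varepsilon$.)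
   Context: Piecewise class: with $t_0=-\infty$, $t_k=\infty$, for $t_1\le\cdots\le t_{k-1}$ in $\mathbb{R}$ and $h_1,\dots,h_k\in\mathcal{H}$, let $f(x;\{h_i\},\{t_i\})=h_i(x)$ for the $i$ with $t_{i-1}<x\le t_i$; $\mathcal{F}_k(\mathcal{H})$ is the set of all such functions (here: $k$-piecewise constant functions). For measurable $f,g$ and $P=\mathrm{Uniform}(0,1)$, $\mathrm{dist}(f,g)=P(x:f(x)\neq g(x))$ and $\mathrm{dist}(f,\mathcal{F})=\inf_{g\in\mathcal{F}}\mathrm{dist}(f,g)$. An $s$-sample $q$-query $\varepsilon$-tester for $\mathcal{F}$ under $P$ is a randomized algorithm that draws a sample $S$ of at most $s$ points i.i.d. from $P$, sequentially queries the value of the unknown target $f^*$ on at most $q$ points of $S$, and outputs accept or reject such that for every measurable $f^*$: if $f^*\in\mathcal{F}$ it accepts with probability $\ge 2/3$, and if $\mathrm{dist}(f^*,\mathcal{F})\ge\varepsilon$ it rejects with probability $\ge 2/3$. Active testing means $q\le s$ in general; passive testing means $q=s$ (all sampled points are queried).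
   Formalization: The formal statement assumes that {x : f(x) ≠ g(x)} is Borel for all measurable f, g from the reals to Y, since otherwise dist(f,g) is undefined (e.g. trivial σ-algebra on two points), and takes k ≥ 1, as the class is empty for k = 0. *)

theory Defs
  imports "HOL-Probability.Probability"
begin

definition constant_functions :: "'y measure \<Rightarrow> (real \<Rightarrow> 'y) set" where
  "constant_functions Y = {(\<lambda>_. y) | y. y \<in> space Y}"

text \<open>The class \<open>F\<^sub>k(H)\<close>. For \<open>k \<ge> 1\<close> every \<open>x\<close> satisfies
  \<open>t (i - 1) < x \<le> t i\<close> for exactly one \<open>i \<in> {1..k}\<close>; for \<open>k = 0\<close> the class is empty.\<close>

definition piecewise_class :: "nat \<Rightarrow> (real \<Rightarrow> 'y) set \<Rightarrow> (real \<Rightarrow> 'y) set" where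
  "piecewise_class k H = {f. \<exists>(t :: nat \<Rightarrow> ereal) (h :: nat \<Rightarrow> real \<Rightarrow> 'y).
      t 0 = - \<infinity> \<and> t k = \<infinity> \<and>
      (\<forall>i\<in>{1..<k}. \<bar>t i\<bar> \<noteq> \<infinity>) \<and>
      (\<forall>i\<in>{1..<k}. \<forall>j\<in>{1..<k}. i \<le> j \<longrightarrow> t i \<le> t j) \<and>
      (\<forall>i\<in>{1..k}. h i \<in> H) \<and>
      (\<forall>x. \<forall>i\<in>{1..k}. t (i - 1) < ereal x \<and> ereal x \<le> t i \<longrightarrow> f x = h i x)}"

definition unif01 :: "real measure" where
  "unif01 = uniform_measure lborel {0<..<1}"

definition fdist :: "(real \<Rightarrow> 'y) \<Rightarrow> (real \<Rightarrow> 'y) \<Rightarrow> real" where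
  "fdist f g = measure unif01 {x. f x \<noteq> g x}"

definition class_dist :: "(real \<Rightarrow> 'y) \<Rightarrow> (real \<Rightarrow> 'y) set \<Rightarrow> real" where
  "class_dist f F = (INF g\<in>F. fdist f g)"

text \<open>The event measured by \<^const>\<open>fdist\<close> is measurable for all measurable \<open>f\<close>, \<open>g\<close>.
  This can fail for a general target space (e.g. for the trivial \<open>\<sigma>\<close>-algebra on two points,
  where every function is measurable), in which case the distance is not defined.\<close>

definition disagreement_measurable :: "'y measure \<Rightarrow> bool" where
  "disagreement_measurable Y \<longleftrightarrow>
     (\<forall>f\<in>borel \<rightarrow>\<^sub>M Y. \<forall>g\<in>borel \<rightarrow>\<^sub>M Y. {x :: real. f x \<noteq> g x} \<in> sets borel)"

text \<open>Sequential querying as a decision tree: \<open>Query i c\<close> asks for the value at the \<open>i\<close>-th sample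
  point and continues with the subtree \<open>c y\<close>, where \<open>y\<close> is the answer; \<open>Decide True\<close> means accept.\<close>

datatype 'y query_tree = Decide bool | Query nat "'y \<Rightarrow> 'y query_tree"

primrec verdict :: "'y query_tree \<Rightarrow> (nat \<Rightarrow> 'y) \<Rightarrow> bool" where
  "verdict (Decide b) v = b"
| "verdict (Query i c) v = verdict (c (v i)) v"

primrec queried :: "'y query_tree \<Rightarrow> (nat \<Rightarrow> 'y) \<Rightarrow> nat set" where
  "queried (Decide b) v = {}"
| "queried (Query i c) v = insert i (queried (c (v i)) v)"

text \<open>A randomized algorithm has a source \<open>coins\<close> of internal randomness, independent of the sample;
  the outcome of the coins and the sample \<open>x 0, \<dots>, x (sample_size - 1)\<close> together determine the
  query tree that is followed.\<close>

record 'y algorithm =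
  coins :: "real measure"
  sample_size :: nat
  strategy :: "real \<Rightarrow> (nat \<Rightarrow> real) \<Rightarrow> 'y query_tree"

definition run_space :: "'y algorithm \<Rightarrow> (real \<times> (nat \<Rightarrow> real)) measure" where
  "run_space A = coins A \<Otimes>\<^sub>M (\<Pi>\<^sub>M i\<in>{..<sample_size A}. unif01)"

definition accept_event :: "'y algorithm \<Rightarrow> (real \<Rightarrow> 'y) \<Rightarrow> (real \<times> (nat \<Rightarrow> real)) set" where
  "accept_event A f = {(r, x) \<in> space (run_space A). verdict (strategy A r x) (\<lambda>i. f (x i))}"

definition reject_event :: "'y algorithm \<Rightarrow> (real \<Rightarrow> 'y) \<Rightarrow> (real \<times> (nat \<Rightarrow> real)) set" where
  "reject_event A f = {(r, x) \<in> space (run_space A). \<not> verdict (strategy A r x) (\<lambda>i. f (x i))}"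

text \<open>The only measurability demanded of an algorithm is that its acceptance probability is
  defined for every measurable target.\<close>

definition is_tester ::
  "'y measure \<Rightarrow> (real \<Rightarrow> 'y) set \<Rightarrow> nat \<Rightarrow> nat \<Rightarrow> real \<Rightarrow> 'y algorithm \<Rightarrow> bool" where
  "is_tester Y F s q \<epsilon> A \<longleftrightarrow>
     prob_space (coins A) \<and> sample_size A \<le> s \<and>
     (\<forall>f\<in>borel \<rightarrow>\<^sub>M Y.
        (\<forall>(r, x)\<in>space (run_space A).
           queried (strategy A r x) (\<lambda>i. f (x i)) \<subseteq> {..<sample_size A} \<and>
           card (queried (strategy A r x) (\<lambda>i. f (x i))) \<le> q) \<and>
        accept_event A f \<in> sets (run_space A) \<and>
        (f \<in> F \<longrightarrow> measure (run_space A) (accept_event A f) \<ge> 2 / 3) \<and>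
        (class_dist f F \<ge> \<epsilon> \<longrightarrow> measure (run_space A) (reject_event A f) \<ge> 2 / 3))"

end

theory Submission
  imports Defs
begin

text \<open>
  Upper bound. Write \<open>D(v)\<close> for the measure of all \<open>y\<close> with \<open>y, y + v \<in> (0,1)\<close> and
  \<open>f y \<noteq> f (y + v)\<close>. If \<open>f\<close> has \<open>k\<close> pieces, then \<open>D(v) \<le> (k - 1) v\<close>. Conversely, sample \<open>f\<close> along the
  grid \<open>x, x + v, x + 2v, \<dots>\<close> with random offset \<open>x \<in> (0,v)\<close>: the resulting step function has on average
  at most \<open>D(v)/v\<close> jumps, and its average distance from \<open>f\<close> is at most \<open>v + (1/v) \<integral>\<^sub>0\<^sup>v D\<close>. Deleting the
  shortest pieces of a step function with \<open>K > k\<close> pieces moves it into the class at cost \<open>(K - k)/k\<close>.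
  Since \<open>D\<close> is subadditive, it follows that with \<open>u = \<epsilon>\<^sup>2/(64 k)\<close> the integral \<open>\<integral>\<^sub>0\<^sup>u D\<close> is at most
  \<open>(k - 1) u\<^sup>2/2\<close> on the class and at least \<open>(k - 1 + k\<epsilon>/4) u\<^sup>2/2\<close> at distance \<open>\<epsilon>\<close> from it. This integral is the
  probability that two random points \<open>a \<le> b \<le> a + u\<close> receive different labels, and it is estimated from
  the pairs of sample points whose indices differ by at most \<open>\<surd>k/\<epsilon>\<close>. This keeps the dependencies
  between pairs so weak that the variance is of the order of the mean, and only points in close
  pairs have to be queried.

  Lower bound. Random labels on \<open>k\<close> equal cells give a function of the class; random choices between
  \<open>ab\<close> and \<open>ba\<close> on the two halves of each of \<open>2k\<close> cells give a function at distance at least \<open>1/4\<close>. Unless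
  two sample points fall into the same cell, both kinds show independent uniform labels.
\<close>

section \<open>Measurability of disagreement in two variables\<close>

primrec digit_remainder :: "nat \<Rightarrow> real \<Rightarrow> real" where
  "digit_remainder 0 z = z"
| "digit_remainder (Suc n) z =
     4 * (digit_remainder n z - (if digit_remainder n z \<ge> 1 then 1 else 0))"

text \<open>Base 4 with digits 0 and 1 only: the tail after any digit stays below the weight of that
  digit, so expansions are unambiguous, and each digit can be read off by the threshold test at 1 in
  \<open>digit_remainder\<close>.\<close>

definition bit_series :: "(nat \<Rightarrow> bool) \<Rightarrow> real" where
  "bit_series B = (\<Sum>m. of_bool (B m) * (1/4) ^ m)"

lemma summable_bits: "summable (\<lambda>m. of_bool (B m) * (1/4 :: real) ^ m)"
  by (rule summable_comparison_test'[OF summable_geometric[of "1/4 :: real"], of 0]) auto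

lemma bit_series_shift: "bit_series B = of_bool (B 0) + bit_series (\<lambda>m. B (Suc m)) / 4"
proof -
  have "bit_series B = (\<Sum>m. of_bool (B (Suc m)) * (1/4) ^ Suc m) + of_bool (B 0)"
    unfolding bit_series_def using suminf_split_head[OF summable_bits[of B]] by simp
  also have "(\<Sum>m. of_bool (B (Suc m)) * (1/4 :: real) ^ Suc m)
      = (\<Sum>m. (of_bool (B (Suc m)) * (1/4) ^ m) / 4)"
    by (simp add: mult.commute)
  also have "\<dots> = bit_series (\<lambda>m. B (Suc m)) / 4"
    unfolding bit_series_def by (rule suminf_divide[OF summable_bits])
  finally show ?thesis by simp
qed

lemma bit_series_bounds: "0 \<le> bit_series B" "bit_series B < 2"
proof -
  show "0 \<le> bit_series B"
    unfolding bit_series_def by (rule suminf_nonneg[OF summable_bits]) simp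
  have "bit_series B \<le> (\<Sum>m. (1/4) ^ m)"
    unfolding bit_series_def by (rule suminf_le[OF _ summable_bits summable_geometric]) auto
  also have "\<dots> = 4/3" by (subst suminf_geometric) auto
  finally show "bit_series B < 2" by simp
qed

text \<open>The shifted series is below 2 and enters with factor 1/4, so bits beyond the first never
  lift the value to 1.\<close>

lemma bit_series_ge_1_iff: "bit_series B \<ge> 1 \<longleftrightarrow> B 0"
  using bit_series_shift[of B] bit_series_bounds[of "\<lambda>m. B (Suc m)"] by (auto split: if_splits)

lemma digit_remainder_bit_series:
  "digit_remainder n (bit_series B) = bit_series (\<lambda>m. B (m + n))"
proof (induction n)
  case (Suc n)
  show ?case
    using bit_series_shift[of "\<lambda>m. B (m + n)"] bit_series_ge_1_iff[of "\<lambda>m. B (m + n)"]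
    by (simp add: Suc)
qed simp

lemma digit_remainder_measurable [measurable]: "digit_remainder n \<in> borel_measurable borel"
  by (induction n) (auto simp: if_distrib)

lemma digit_remainder_ge_1_iff: "digit_remainder n (bit_series B) \<ge> 1 \<longleftrightarrow> B n"
  by (simp add: digit_remainder_bit_series bit_series_ge_1_iff)

text \<open>Recovers a real from the indicator of the enumerated rationals below it. Being a
  countable supremum, it is measurable in the bits; the value -\<infinity> makes unselected
  rationals harmless.\<close>

definition rat_cut :: "(nat \<Rightarrow> bool) \<Rightarrow> real" where
  "rat_cut B = real_of_ereal (SUP n. if B n then ereal (of_rat (from_nat n)) else - \<infinity>)"

lemma rat_cut_less: "rat_cut (\<lambda>n. of_rat (from_nat n) < x) = x"
proof -
  have "(SUP n. if of_rat (from_nat n) < x then ereal (of_rat (from_nat n)) else - \<infinity>) = ereal x"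
  proof (rule antisym)
    show "(SUP n. if of_rat (from_nat n) < x then ereal (of_rat (from_nat n)) else - \<infinity>) \<le> ereal x"
      by (rule SUP_least) auto
    show "ereal x \<le> (SUP n. if of_rat (from_nat n) < x then ereal (of_rat (from_nat n)) else - \<infinity>)"
    proof (rule dense_le)
      fix y assume "y < ereal x"
      then obtain z where z: "y < ereal z" "z < x"
        using ereal_dense2 by force
      obtain r where r: "z < of_rat r" "of_rat r < x" using of_rat_dense z(2) by blast
      have "ereal z \<le> (if of_rat (from_nat (to_nat r)) < x then ereal (of_rat (from_nat (to_nat r))) else - \<infinity>)"
        using r by simp
      also have "\<dots> \<le> (SUP n. if of_rat (from_nat n) < x then ereal (of_rat (from_nat n)) else - \<infinity>)"
        by (rule SUP_upper) simp
      finally show "y \<le> (SUP n. if of_rat (from_nat n) < x then ereal (of_rat (from_nat n)) else - \<infinity>)"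
        using z(1) by simp
    qed
  qed
  then show ?thesis by (simp add: rat_cut_def)
qed

lemma rat_cut_measurable:
  assumes [measurable]: "\<And>n. Measurable.pred M (\<lambda>z. B z n)"
  shows "(\<lambda>z. rat_cut (B z)) \<in> borel_measurable M"
  unfolding rat_cut_def by measurable

lemma bit_series_measurable:
  assumes [measurable]: "\<And>n. Measurable.pred M (\<lambda>z. B z n)"
  shows "(\<lambda>z. bit_series (B z)) \<in> borel_measurable M"
  unfolding bit_series_def by measurable

text \<open>The hypothesis only speaks of functions of one real variable. The plane embeds measurably into
  the line with measurable left inverse (interleave the rational cuts of the two coordinates as
  digits), so that two independent arguments can be coded by a single one.\<close>

lemma disagreement_pairs_measurable:
  assumes Y: "disagreement_measurable Y" and f [measurable]: "f \<in> borel \<rightarrow>\<^sub>M Y"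
  shows "{p :: real \<times> real. f (fst p) \<noteq> f (snd p)} \<in> sets (borel \<Otimes>\<^sub>M borel)"
proof -
  define enc :: "real \<times> real \<Rightarrow> real" where
    "enc p = bit_series (\<lambda>n. of_rat (from_nat (n div 2)) < (if even n then fst p else snd p))" for p
  define dec where "dec b z = rat_cut (\<lambda>n. digit_remainder (2 * n + b) z \<ge> 1)" for b z
  have dec0: "dec 0 (enc p) = fst p" and dec1: "dec 1 (enc p) = snd p" for p
    unfolding dec_def enc_def digit_remainder_ge_1_iff by (simp_all add: rat_cut_less)
  have [measurable]: "dec b \<in> borel_measurable borel" for b
    unfolding dec_def by (rule rat_cut_measurable) measurable
  have enc: "enc \<in> borel_measurable (borel \<Otimes>\<^sub>M borel)"
    unfolding enc_def by (rule bit_series_measurable) measurable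
  have "(\<lambda>z. f (dec 0 z)) \<in> borel \<rightarrow>\<^sub>M Y" "(\<lambda>z. f (dec 1 z)) \<in> borel \<rightarrow>\<^sub>M Y"
    by measurable
  then have "{z. f (dec 0 z) \<noteq> f (dec 1 z)} \<in> sets borel"
    using Y[unfolded disagreement_measurable_def, rule_format] by simp
  from measurable_sets[OF enc this] show ?thesis
    by (simp add: vimage_def dec0 dec1 space_pair_measure del: One_nat_def)
qed

section \<open>Piecewise constant functions\<close>

lemma piece_cover:
  fixes t :: "nat \<Rightarrow> ereal"
  assumes "t 0 = - \<infinity>" "t k = \<infinity>"
  obtains i where "i \<in> {1..k}" "t (i - 1) < ereal x" "ereal x \<le> t i"
proof -
  \<comment> \<open>Minimality of the index supplies the strict lower bound, and
    \<open>t 0 = - \<infinity>\<close> keeps the index positive.\<close>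
  define i where "i = (LEAST i. ereal x \<le> t i)"
  have i: "ereal x \<le> t i" "i \<le> k"
    unfolding i_def using assms(2) by (auto intro: LeastI2[of _ k] Least_le)
  have "i \<noteq> 0" using i(1) assms(1) by (cases i) auto
  moreover from this have "\<not> ereal x \<le> t (i - 1)"
    unfolding i_def by (intro not_less_Least) (auto simp: i_def)
  ultimately show thesis using that[of i] i by auto
qed

lemma piece_mono:
  fixes t :: "nat \<Rightarrow> ereal"
  assumes "t 0 = - \<infinity>" "t k = \<infinity>" "\<forall>i\<in>{1..<k}. \<forall>j\<in>{1..<k}. i \<le> j \<longrightarrow> t i \<le> t j"
    and "i \<le> j" "j \<le> k"
  shows "t i \<le> t j"
proof (cases "i = 0 \<or> j = k")
  case True
  then show ?thesis using assms(1,2) by auto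
next
  case False
  then show ?thesis using assms by auto
qed

lemma piecewise_classI:
  assumes "t 0 = - \<infinity>" "t k = \<infinity>" "\<And>i. i \<in> {1..<k} \<Longrightarrow> \<bar>t i\<bar> \<noteq> \<infinity>"
    and "\<And>i j. i \<in> {1..<k} \<Longrightarrow> j \<in> {1..<k} \<Longrightarrow> i \<le> j \<Longrightarrow> t i \<le> t j"
    and "\<And>i. i \<in> {1..k} \<Longrightarrow> h i \<in> H"
    and "\<And>x i. i \<in> {1..k} \<Longrightarrow> t (i - 1) < ereal x \<Longrightarrow> ereal x \<le> t i \<Longrightarrow> f x = h i x"
  shows "f \<in> piecewise_class k H"
  unfolding piecewise_class_def
  by (intro CollectI exI[of _ t] exI[of _ h] conjI allI ballI impI) (use assms in auto)

lemma constant_in_piecewise: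
  assumes "y \<in> space Y"
  shows "(\<lambda>_. y) \<in> piecewise_class 1 (constant_functions Y)"
  unfolding piecewise_class_def constant_functions_def using assms
  by (intro CollectI exI[of _ "\<lambda>i. if i = 0 then - \<infinity> else \<infinity>"] exI[of _ "\<lambda>_ _. y"]) auto

text \<open>All cut points are lowered to at most c. Pieces beyond c become empty, which the class
  permits, and the interval right of c becomes the additional last piece.\<close>

lemma piecewise_append:
  assumes f: "f \<in> piecewise_class k (constant_functions Y)" and y: "y \<in> space Y"
  shows "(\<lambda>x. if x \<le> c then f x else y) \<in> piecewise_class (Suc k) (constant_functions Y)"
proof -
  obtain t h where t: "t 0 = - \<infinity>" "t k = \<infinity>" "\<forall>i\<in>{1..<k}. \<bar>t i\<bar> \<noteq> \<infinity>"
      "\<forall>i\<in>{1..<k}. \<forall>j\<in>{1..<k}. i \<le> j \<longrightarrow> t i \<le> t j"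
    and h: "\<forall>i\<in>{1..k}. h i \<in> constant_functions Y"
    and fh: "\<forall>x. \<forall>i\<in>{1..k}. t (i - 1) < ereal x \<and> ereal x \<le> t i \<longrightarrow> f x = h i x"
    using f unfolding piecewise_class_def by blast
  define t' where "t' i = (if i = 0 then - \<infinity> else if i \<le> k then min (t i) (ereal c) else \<infinity>)" for i
  define h' where "h' i = (if i \<le> k then h i else (\<lambda>_. y))" for i
  have fin: "\<bar>t' i\<bar> \<noteq> \<infinity>" if "i \<in> {1..<Suc k}" for i
  proof -
    have "\<bar>t i\<bar> \<noteq> \<infinity> \<or> t i = \<infinity>" using that t(2,3) by (cases "i = k") auto
    then show ?thesis using that by (auto simp: t'_def min_def)
  qed
  have mono: "t' i \<le> t' j" if "i \<in> {1..<Suc k}" "j \<in> {1..<Suc k}" "i \<le> j" for i j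
    using that piece_mono[OF t(1,2,4) that(3)] by (auto simp: t'_def min_def)
  have h': "h' i \<in> constant_functions Y" if "i \<in> {1..Suc k}" for i
    using that h y by (auto simp: h'_def constant_functions_def)
  have val: "(if x \<le> c then f x else y) = h' i x"
    if i: "i \<in> {1..Suc k}" and x: "t' (i - 1) < ereal x" "ereal x \<le> t' i" for x i
  proof (cases "i \<le> k")
    case True
    then have *: "ereal x \<le> t i" "x \<le> c" using i x by (auto simp: t'_def)
    have "t (i - 1) < ereal x"
      using x True * t(1) by (cases "i = 1") (auto simp: t'_def min_def split: if_splits)
    with * True i fh show ?thesis by (auto simp: h'_def)
  next
    case False
    then have "i = Suc k" using i by auto
    moreover have "t' k = ereal c \<or> k = 0" by (simp add: t'_def t(2))
    moreover have "k \<noteq> 0" using t by (metis MInfty_neq_PInfty(1))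
    ultimately show ?thesis using x by (auto simp: h'_def)
  qed
  show ?thesis
    by (rule piecewise_classI[of t' _ h', OF _ _ fin mono h' val]) (simp_all add: t'_def)
qed

text \<open>The last piece is cut at c and the same value is appended there, which leaves f
  unchanged.\<close>

lemma piecewise_class_Suc_mono:
  assumes f: "f \<in> piecewise_class k (constant_functions Y)"
  shows "f \<in> piecewise_class (Suc k) (constant_functions Y)"
proof -
  obtain t h where t: "t 0 = - \<infinity>" "t k = \<infinity>" "\<forall>i\<in>{1..<k}. \<bar>t i\<bar> \<noteq> \<infinity>"
    and h: "\<forall>i\<in>{1..k}. h i \<in> constant_functions Y"
    and fh: "\<forall>x. \<forall>i\<in>{1..k}. t (i - 1) < ereal x \<and> ereal x \<le> t i \<longrightarrow> f x = h i x"
    using f unfolding piecewise_class_def by blast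
  have k: "k \<noteq> 0" using t by (metis MInfty_neq_PInfty(1))
  \<comment> \<open>For \<open>k = 1\<close> the cut \<open>t 0\<close> is infinite and c takes the
    default 0; all that matters is \<open>t (k - 1) \<le> c\<close>.\<close>
  define c where "c = real_of_ereal (t (k - 1))"
  obtain y where y: "y \<in> space Y" "h k = (\<lambda>_. y)"
    using h k by (force simp: constant_functions_def)
  have "t (k - 1) \<le> ereal c"
    using t k unfolding c_def by (cases "k = 1") (auto simp: ereal_real)
  then have "f x = y" if "c < x" for x
  proof -
    have "t (k - 1) < ereal x"
      using \<open>t (k - 1) \<le> ereal c\<close> that by (metis le_less_trans less_ereal.simps(1))
    then show ?thesis using fh[rule_format, of k x] y(2) k t(2) by simp
  qed
  then have "f = (\<lambda>x. if x \<le> c then f x else y)"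
    by (auto simp: fun_eq_iff)
  with piecewise_append[OF f y(1), of c] show ?thesis by simp
qed

lemma piecewise_class_mono:
  assumes "f \<in> piecewise_class j (constant_functions Y)" "j \<le> k"
  shows "f \<in> piecewise_class k (constant_functions Y)"
  using assms(2,1) by (induction rule: dec_induct) (auto intro: piecewise_class_Suc_mono)

lemma piecewise_class_measurable:
  assumes f: "f \<in> piecewise_class k (constant_functions Y)"
  shows "f \<in> borel \<rightarrow>\<^sub>M Y"
proof -
  obtain t h where t: "t 0 = - \<infinity>" "t k = \<infinity>"
    and h: "\<forall>i\<in>{1..k}. h i \<in> constant_functions Y"
    and fh: "\<forall>x. \<forall>i\<in>{1..k}. t (i - 1) < ereal x \<and> ereal x \<le> t i \<longrightarrow> f x = h i x"
    using f unfolding piecewise_class_def by blast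
  define y where "y i = h i 0" for i
  have y: "h i = (\<lambda>_. y i)" "y i \<in> space Y" if "i \<in> {1..k}" for i
    using h that by (force simp: constant_functions_def y_def)+
  have fy: "f x = y i" if "i \<in> {1..k}" "t (i - 1) < ereal x" "ereal x \<le> t i" for x i
    using fh that y(1) by auto
  have inY: "f x \<in> space Y" for x
    using piece_cover[OF t, of x] fy y(2) by metis
  have "f -` A \<inter> space borel \<in> sets borel" for A
  proof -
    have "f -` A \<inter> space borel = (\<Union>i\<in>{i\<in>{1..k}. y i \<in> A}. {x. t (i - 1) < ereal x \<and> ereal x \<le> t i})"
    proof (intro set_eqI iffI)
      fix x assume x: "x \<in> f -` A \<inter> space borel"
      obtain i where i: "i \<in> {1..k}" "t (i - 1) < ereal x" "ereal x \<le> t i"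
        by (rule piece_cover[OF t])
      then show "x \<in> (\<Union>i\<in>{i\<in>{1..k}. y i \<in> A}. {x. t (i - 1) < ereal x \<and> ereal x \<le> t i})"
        using fy[OF i] x by auto
    qed (use fy in auto)
    also have "\<dots> \<in> sets borel" by (intro sets.finite_UN) auto
    finally show ?thesis .
  qed
  with inY show ?thesis by (intro measurableI) auto
qed

text \<open>If x lies in piece i and y to its right has another value, the right end of piece i
  separates them. Later arguments bound the changes of value of class members through these at most
  k - 1 real numbers.\<close>

lemma piecewise_breakpoints:
  assumes f: "f \<in> piecewise_class k (constant_functions Y)"
  obtains r :: "nat \<Rightarrow> real"
  where "\<And>x y. x \<le> y \<Longrightarrow> f x \<noteq> f y \<Longrightarrow> \<exists>i\<in>{1..<k}. x \<le> r i \<and> r i < y"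
proof -
  obtain t h where t: "t 0 = - \<infinity>" "t k = \<infinity>" "\<forall>i\<in>{1..<k}. \<bar>t i\<bar> \<noteq> \<infinity>"
    and h: "\<forall>i\<in>{1..k}. h i \<in> constant_functions Y"
    and fh: "\<forall>x. \<forall>i\<in>{1..k}. t (i - 1) < ereal x \<and> ereal x \<le> t i \<longrightarrow> f x = h i x"
    using f unfolding piecewise_class_def by blast
  define r where "r i = real_of_ereal (t i)" for i
  have r: "t i = ereal (r i)" if "i \<in> {1..<k}" for i
    using t(3) that by (simp add: r_def ereal_real)
  have "\<exists>i\<in>{1..<k}. x \<le> r i \<and> r i < y" if le: "x \<le> y" and neq: "f x \<noteq> f y" for x y
  proof -
    obtain i where i: "i \<in> {1..k}" "t (i - 1) < ereal x" "ereal x \<le> t i"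
      by (rule piece_cover[OF t(1,2)])
    have less: "t i < ereal y"
    proof (rule ccontr)
      assume "\<not> ?thesis"
      moreover have "ereal x \<le> ereal y" using le by simp
      moreover from this i(2) have "t (i - 1) < ereal y" by (rule less_le_trans[rotated])
      ultimately have "f x = h i x" "f y = h i y"
        using fh[rule_format, OF i(1), of x] fh[rule_format, OF i(1), of y] i(2,3)
        by (simp_all add: not_less)
      moreover have "h i x = h i y" using h i(1) by (force simp: constant_functions_def)
      ultimately show False using neq by simp
    qed
    then have "i \<in> {1..<k}" using i(1) t(2) by (cases "i = k") auto
    then show ?thesis using less i(3) r by (intro bexI[of _ i]) auto
  qed
  then show thesis by (rule that)
qed

section \<open>The uniform distribution, and reducing the number of pieces\<close>

lemma sets_unif01 [measurable_cong, simp]: "sets unif01 = sets borel"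
  by (simp add: unif01_def)

lemma space_unif01 [simp]: "space unif01 = UNIV"
  by (simp add: unif01_def)

lemma prob_space_unif01: "prob_space unif01"
  unfolding unif01_def by (rule prob_space_uniform_measure) auto

interpretation unif01: prob_space unif01
  by (rule prob_space_unif01)

lemma emeasure_unif01: "S \<in> sets borel \<Longrightarrow> emeasure unif01 S = emeasure lborel ({0<..<1} \<inter> S)"
  unfolding unif01_def by (subst emeasure_uniform_measure) (auto simp: divide_ennreal_def)

lemma nn_integral_unif01:
  "g \<in> borel_measurable borel \<Longrightarrow> (\<integral>\<^sup>+x. g x \<partial>unif01) = (\<integral>\<^sup>+x. g x * indicator {0<..<1} x \<partial>lborel)"
  unfolding unif01_def by (subst nn_integral_uniform_measure) (auto simp: divide_ennreal_def)

lemma fdist_triangle: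
  assumes Y: "disagreement_measurable Y" and m: "f \<in> borel \<rightarrow>\<^sub>M Y" "g \<in> borel \<rightarrow>\<^sub>M Y" "h \<in> borel \<rightarrow>\<^sub>M Y"
  shows "fdist f h \<le> fdist f g + fdist g h"
proof -
  have s: "{x. f x \<noteq> g x} \<in> sets unif01" "{x. g x \<noteq> h x} \<in> sets unif01" "{x. f x \<noteq> h x} \<in> sets unif01"
    using Y[unfolded disagreement_measurable_def, rule_format] m by simp_all
  have "fdist f h \<le> measure unif01 ({x. f x \<noteq> g x} \<union> {x. g x \<noteq> h x})"
    unfolding fdist_def by (rule unif01.finite_measure_mono) (use s in auto)
  also have "\<dots> \<le> fdist f g + fdist g h"
    unfolding fdist_def by (rule measure_Un_le) (use s in auto)
  finally show ?thesis .
qed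

text \<open>Among the first K of the K + 1 disjoint pieces one has mass at most 1/K. It receives the
  value of its right neighbour, and the cut between the two disappears. The last piece is left out
  of the count because it has no right neighbour.\<close>

lemma piecewise_merge:
  assumes f: "f \<in> piecewise_class (Suc K) (constant_functions Y)" and K: "K \<ge> 1"
  obtains g where "g \<in> piecewise_class K (constant_functions Y)" "fdist f g \<le> 1 / real K"
proof -
  obtain t h where t: "t 0 = - \<infinity>" "t (Suc K) = \<infinity>" "\<forall>i\<in>{1..<Suc K}. \<bar>t i\<bar> \<noteq> \<infinity>"
      "\<forall>i\<in>{1..<Suc K}. \<forall>j\<in>{1..<Suc K}. i \<le> j \<longrightarrow> t i \<le> t j"
    and h: "\<forall>i\<in>{1..Suc K}. h i \<in> constant_functions Y"
    and fh: "\<forall>x. \<forall>i\<in>{1..Suc K}. t (i - 1) < ereal x \<and> ereal x \<le> t i \<longrightarrow> f x = h i x"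
    using f unfolding piecewise_class_def by blast
  note mono = piece_mono[OF t(1,2,4)]
  define I where "I i = {x. t (i - 1) < ereal x \<and> ereal x \<le> t i}" for i
  have [measurable]: "I i \<in> sets borel" for i unfolding I_def by measurable
  have disj: "disjoint_family_on I {1..K}"
  proof -
    have "I i \<inter> I j = {}" if "i < j" "j \<le> K" for i j
    proof -
      have "t i \<le> t (j - 1)" using that by (intro mono) auto
      then show ?thesis by (auto simp: I_def)
    qed
    then show ?thesis
      unfolding disjoint_family_on_def by (metis Int_commute atLeastAtMost_iff linorder_neqE_nat)
  qed
  \<comment> \<open>Pigeonhole: K disjoint sets cannot all have probability above 1/K.\<close>
  have "\<exists>i\<in>{1..K}. measure unif01 (I i) \<le> 1 / real K"
  proof (rule ccontr)
    assume "\<not> ?thesis"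
    then have "(\<Sum>i\<in>{1..K}. 1 / real K) < (\<Sum>i\<in>{1..K}. measure unif01 (I i))"
      using K by (intro sum_strict_mono) (auto simp: not_le)
    also have "\<dots> = measure unif01 (\<Union>i\<in>{1..K}. I i)"
      by (rule unif01.finite_measure_finite_Union[symmetric]) (use disj in auto)
    also have "\<dots> \<le> 1" by simp
    finally show False using K by simp
  qed
  then obtain i where i: "i \<in> {1..K}" and le: "measure unif01 (I i) \<le> 1 / real K" by blast
  define g where "g x = (if x \<in> I i then h (Suc i) x else f x)" for x
  \<comment> \<open>The cut \<open>t i\<close> is skipped, so indices from i on move up by one, and
    piece i of the new function is the union of the old pieces i and \<open>Suc i\<close>.\<close>
  define t' where "t' j = (if j < i then t j else t (Suc j))" for j
  define h' where "h' j = (if j < i then h j else h (Suc j))" for j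
  have val: "g x = h' j x" if j: "j \<in> {1..K}" and x: "t' (j - 1) < ereal x" "ereal x \<le> t' j" for x j
  proof -
    consider "j < i" | "j = i" | "j > i" by linarith
    then show ?thesis
    proof cases
      case 1
      then have "t j \<le> t (i - 1)" using i by (intro mono) auto
      then have "x \<notin> I i" using x 1 by (auto simp: I_def t'_def)
      moreover have "j - 1 < i" using 1 by simp
      then have "t (j - 1) < ereal x" "ereal x \<le> t j" using x 1 by (simp_all add: t'_def)
      ultimately show ?thesis using 1 j fh by (auto simp: g_def h'_def)
    next
      case 2
      then have "t (i - 1) < ereal x" "ereal x \<le> t (Suc i)" using x i by (auto simp: t'_def)
      then show ?thesis using 2 fh i by (auto simp: g_def I_def h'_def not_le)
    next
      case 3
      then have "\<not> j - 1 < i" "Suc (j - 1) = j" by auto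
      then have "t j < ereal x" "ereal x \<le> t (Suc j)" using x 3 by (simp_all add: t'_def)
      moreover have "t i \<le> t j" using 3 j by (intro mono) auto
      ultimately show ?thesis using 3 fh j by (auto simp: g_def I_def h'_def)
    qed
  qed
  have "g \<in> piecewise_class K (constant_functions Y)"
  proof (rule piecewise_classI[of t' _ h', OF _ _ _ _ _ val])
    show "t' 0 = - \<infinity>" "t' K = \<infinity>" using t(1,2) i by (auto simp: t'_def)
    show "\<bar>t' j\<bar> \<noteq> \<infinity>" if "j \<in> {1..<K}" for j using t(3) that by (auto simp: t'_def)
    show "t' j \<le> t' l" if "j \<in> {1..<K}" "l \<in> {1..<K}" "j \<le> l" for j l
      using that by (auto simp: t'_def intro!: mono)
    show "h' j \<in> constant_functions Y" if "j \<in> {1..K}" for j using h that by (auto simp: h'_def)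
  qed
  moreover have "fdist f g \<le> 1 / real K"
  proof -
    have "{x. f x \<noteq> g x} \<subseteq> I i" by (auto simp: g_def)
    then show ?thesis
      using le unif01.finite_measure_mono[of "{x. f x \<noteq> g x}" "I i"] unfolding fdist_def by simp
  qed
  ultimately show thesis by (rule that)
qed

text \<open>Pieces are removed one at a time; a removal that leaves k + j pieces costs at most 1/(k
  + j) \<le> 1/k, and the costs add up by the triangle inequality.\<close>

lemma piecewise_merge_many:
  assumes Y: "disagreement_measurable Y" and k: "k \<ge> 1"
    and f: "f \<in> piecewise_class (k + m) (constant_functions Y)"
  obtains g where "g \<in> piecewise_class k (constant_functions Y)" "fdist f g \<le> real m / real k"
proof -
  have "\<exists>g\<in>piecewise_class k (constant_functions Y). fdist f g \<le> real m / real k"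
    using f
  proof (induction m arbitrary: f)
    case 0
    then show ?case by (intro bexI[of _ f]) (auto simp: fdist_def)
  next
    case (Suc m)
    obtain g where g: "g \<in> piecewise_class (k + m) (constant_functions Y)" "fdist f g \<le> 1 / real (k + m)"
      using piecewise_merge[of f "k + m" Y] Suc.prems k by auto
    obtain h where h: "h \<in> piecewise_class k (constant_functions Y)" "fdist g h \<le> real m / real k"
      using Suc.IH[OF g(1)] by blast
    have "fdist f h \<le> fdist f g + fdist g h"
      using piecewise_class_measurable Suc.prems g(1) h(1) by (intro fdist_triangle[OF Y]) blast+
    also have "\<dots> \<le> 1 / real k + real m / real k"
      using g(2) h(2) k by (intro add_mono order.trans[OF g(2)]) (auto simp: frac_le)
    finally show ?case using h(1) by (intro bexI[of _ h]) (auto simp: add_divide_distrib)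
  qed
  then show thesis using that by blast
qed

section \<open>Noise and grid approximations\<close>

text \<open>For w \<ge> 0 the two inequalities put both y and y + w into (0,1), so
  \<open>noise f w\<close> is the quantity D(w) of the overview. Values in \<open>ennreal\<close>
  allow sums and Tonelli without integrability side conditions.\<close>

definition jump :: "(real \<Rightarrow> 'y) \<Rightarrow> real \<Rightarrow> real \<Rightarrow> ennreal" where
  "jump f y w = of_bool (0 < y \<and> y + w < 1 \<and> f y \<noteq> f (y + w))"

definition noise :: "(real \<Rightarrow> 'y) \<Rightarrow> real \<Rightarrow> ennreal" where
  "noise f w = (\<integral>\<^sup>+y. jump f y w \<partial>lborel)"

lemma jump_measurable:
  assumes f: "{p :: real \<times> real. f (fst p) \<noteq> f (snd p)} \<in> sets (borel \<Otimes>\<^sub>M borel)"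
  shows "(\<lambda>(y, w). jump f y w) \<in> borel_measurable (borel \<Otimes>\<^sub>M borel)"
proof -
  have [measurable]: "Measurable.pred (borel \<Otimes>\<^sub>M borel) (\<lambda>p :: real \<times> real. f (fst p) \<noteq> f (snd p))"
    using f unfolding pred_def by (simp add: space_pair_measure)
  have "Measurable.pred (borel \<Otimes>\<^sub>M borel)
      ((\<lambda>p :: real \<times> real. f (fst p) \<noteq> f (snd p)) \<circ> (\<lambda>(y, w). (y, y + w)))"
    unfolding comp_def by (rule measurable_compose[where N = "borel \<Otimes>\<^sub>M borel"]) measurable
  then have [measurable]: "Measurable.pred (borel \<Otimes>\<^sub>M borel) (\<lambda>(y, w). f y \<noteq> f (y + w))"
    by (simp add: comp_def case_prod_beta')
  show ?thesis unfolding jump_def case_prod_beta'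
    by (measurable)
qed

context
  fixes f :: "real \<Rightarrow> 'y"
  assumes f: "{p :: real \<times> real. f (fst p) \<noteq> f (snd p)} \<in> sets (borel \<Otimes>\<^sub>M borel)"
begin

lemma jump_measurable_pair [measurable]: "(\<lambda>(y, w). jump f y w) \<in> borel_measurable (borel \<Otimes>\<^sub>M borel)"
  by (rule jump_measurable[OF f])

lemma jump_measurable_compose [measurable (raw)]:
  assumes [measurable]: "g \<in> borel_measurable M" "h \<in> borel_measurable M"
  shows "(\<lambda>z. jump f (g z) (h z)) \<in> borel_measurable M"
proof -
  have "(\<lambda>z. (\<lambda>(y, w). jump f y w) (g z, h z)) \<in> borel_measurable M"
    by measurable
  then show ?thesis by simp
qed

lemma noise_measurable [measurable]: "noise f \<in> borel_measurable borel"
  unfolding noise_def by measurable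

text \<open>A change between y and y + v + w is a change between y and y + v or between y + v and y
  + v + w. The second event is a translate of the one measured by \<open>noise f w\<close>.\<close>

lemma noise_add_le:
  assumes "0 \<le> v" "0 \<le> w"
  shows "noise f (v + w) \<le> noise f v + noise f w"
proof -
  have "noise f (v + w) \<le> (\<integral>\<^sup>+y. jump f y v + jump f (v + 1 * y) w \<partial>lborel)"
    unfolding noise_def using assms
    by (intro nn_integral_mono) (auto simp: jump_def algebra_simps of_bool_def)
  also have "\<dots> = noise f v + (\<integral>\<^sup>+y. jump f (v + 1 * y) w \<partial>lborel)"
    unfolding noise_def by (rule nn_integral_add) measurable
  also have "(\<integral>\<^sup>+y. jump f (v + 1 * y) w \<partial>lborel) = noise f w"
    unfolding noise_def
    using nn_integral_real_affine[of "\<lambda>y. jump f y w" 1 v] by simp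
  finally show ?thesis .
qed

lemma noise_mult_le:
  assumes "0 \<le> v"
  shows "noise f (real m * v) \<le> of_nat m * noise f v"
proof (induction m)
  case 0
  then show ?case by (simp add: noise_def jump_def)
next
  case (Suc m)
  have "noise f (real (Suc m) * v) \<le> noise f (real m * v) + noise f v"
    using noise_add_le[of "real m * v" v] assms by (simp add: algebra_simps)
  also have "\<dots> \<le> of_nat m * noise f v + noise f v"
    using Suc by (intro add_right_mono)
  finally show ?case by (simp add: algebra_simps)
qed

end

text \<open>A jump of length v from y has to cross some breakpoint \<open>r i\<close>, which
  confines y to an interval of length v for each of the k - 1 breakpoints.\<close>

lemma noise_le_of_piecewise:
  assumes f: "f \<in> piecewise_class k (constant_functions Y)" and k: "k \<ge> 1" and v: "0 \<le> v"
  shows "noise f v \<le> ennreal ((real k - 1) * v)"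
proof -
  obtain r where r: "\<And>x y. x \<le> y \<Longrightarrow> f x \<noteq> f y \<Longrightarrow> \<exists>i\<in>{1..<k}. x \<le> r i \<and> r i < y"
    by (rule piecewise_breakpoints[OF f]) blast
  have "noise f v \<le> (\<integral>\<^sup>+y. (\<Sum>i\<in>{1..<k}. indicator {r i - v..r i} y) \<partial>lborel)"
    unfolding noise_def
  proof (intro nn_integral_mono)
    fix y
    show "jump f y v \<le> (\<Sum>i\<in>{1..<k}. indicator {r i - v..r i} y)"
    proof (cases "f y \<noteq> f (y + v)")
      case True
      then obtain i where i: "i \<in> {1..<k}" "y \<le> r i" "r i < y + v"
        using r[of y "y + v"] v by auto
      have "jump f y v \<le> indicator {r i - v..r i} y"
        using i by (auto simp: jump_def of_bool_def)
      also have "\<dots> \<le> (\<Sum>i\<in>{1..<k}. indicator {r i - v..r i} y)"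
        by (rule member_le_sum) (use i in auto)
      finally show ?thesis .
    qed (simp add: jump_def)
  qed
  also have "\<dots> = (\<Sum>i\<in>{1..<k}. ennreal v)"
    using v by (subst nn_integral_sum) auto
  also have "\<dots> = ennreal ((real k - 1) * v)"
  proof -
    have "ennreal ((real k - 1) * v) = ennreal (real (k - 1)) * ennreal v"
      using k v by (simp add: of_nat_diff ennreal_mult)
    then show ?thesis by (simp add: ennreal_of_nat_eq_real_of_nat)
  qed
  finally show ?thesis .
qed

lemma nn_integral_linear_Icc:
  fixes c u :: real
  assumes "0 \<le> c" "0 \<le> u"
  shows "(\<integral>\<^sup>+w\<in>{0..u}. ennreal (c * w) \<partial>lborel) = ennreal (u\<^sup>2 / 2 * c)"
proof -
  have "((\<lambda>w. c * w\<^sup>2 / 2) has_real_derivative c * w) (at w)" for w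
    by (auto intro!: derivative_eq_intros)
  then have "(\<integral>\<^sup>+w\<in>{0..u}. ennreal (c * w) \<partial>lborel) = ennreal (c * u\<^sup>2 / 2 - c * 0\<^sup>2 / 2)"
    using assms by (intro nn_integral_FTC_Icc) auto
  then show ?thesis by (simp add: mult.commute)
qed

lemma noise_integral_le_of_piecewise:
  assumes f: "f \<in> piecewise_class k (constant_functions Y)" and u: "0 \<le> u" and k: "k \<ge> 1"
  shows "(\<integral>\<^sup>+w\<in>{0..u}. noise f w \<partial>lborel) \<le> ennreal (u\<^sup>2 / 2 * (real k - 1))"
proof -
  have "(\<integral>\<^sup>+w\<in>{0..u}. noise f w \<partial>lborel) \<le> (\<integral>\<^sup>+w\<in>{0..u}. ennreal ((real k - 1) * w) \<partial>lborel)"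
    by (intro nn_integral_mono) (auto split: split_indicator intro: noise_le_of_piecewise[OF f k])
  then show ?thesis using nn_integral_linear_Icc[of "real k - 1" u] u k by simp
qed

text \<open>Built in the manner of \<open>piecewise_append\<close>, one grid point at a time, so
  that pieces can be counted by induction. Each right-closed cell carries the value of f at its left
  grid point. Grid points at or beyond 1 are ignored, so that only changes inside (0,1) create
  pieces.\<close>

primrec grid_step :: "(real \<Rightarrow> 'y) \<Rightarrow> real \<Rightarrow> real \<Rightarrow> nat \<Rightarrow> real \<Rightarrow> 'y" where
  "grid_step f x v 0 = (\<lambda>z. f x)"
| "grid_step f x v (Suc n) = (\<lambda>z. if z \<le> x + real (Suc n) * v \<or> 1 \<le> x + real (Suc n) * v
     then grid_step f x v n z else f (x + real (Suc n) * v))"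

lemma grid_step_last:
  assumes "x + real n * v < z" "x + real n * v < 1"
  shows "grid_step f x v n z = f (x + real n * v)"
  using assms by (cases n) auto

lemma grid_step_eq:
  assumes v: "0 < v" and z: "x + real i * v < z" "z \<le> x + real (Suc i) * v" "z < 1" and "i \<le> n"
  shows "grid_step f x v n z = f (x + real i * v)"
  using \<open>i \<le> n\<close>
proof (induction n)
  case 0
  then show ?case by simp
next
  case (Suc n)
  show ?case
  proof (cases "i = Suc n")
    case True
    then show ?thesis using grid_step_last[of x "Suc n" v z f] z by simp
  next
    case False
    have "x + real (Suc i) * v \<le> x + real (Suc n) * v"
      using False Suc.prems v by simp
    then have "z \<le> x + real (Suc n) * v" using z(2) by linarith
    then show ?thesis using Suc False by simp
  qed
qed

text \<open>A new piece is opened only at a grid point below 1 where the sampled value differs from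
  the previous one; otherwise the recursion step leaves the function as it is.\<close>

lemma grid_step_piecewise:
  assumes f: "\<And>x. f x \<in> space Y" and v: "0 < v"
  shows "grid_step f x v n \<in> piecewise_class
    (Suc (card {i. i < n \<and> x + real (Suc i) * v < 1 \<and> f (x + real i * v) \<noteq> f (x + real (Suc i) * v)}))
    (constant_functions Y)" (is "_ \<in> piecewise_class (Suc (card (?S n))) _")
proof (induction n)
  case 0
  then show ?case using constant_in_piecewise[OF f] by simp
next
  case (Suc n)
  let ?P = "x + real (Suc n) * v < 1 \<and> f (x + real n * v) \<noteq> f (x + real (Suc n) * v)"
  have S: "?S (Suc n) = (if ?P then insert n (?S n) else ?S n)"
    by (auto simp: less_Suc_eq)
  have fin: "finite (?S n)" by simp
  show ?case
  proof (cases ?P)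
    case True
    have "grid_step f x v (Suc n) = (\<lambda>z. if z \<le> x + real (Suc n) * v then grid_step f x v n z else f (x + real (Suc n) * v))"
      using True by (auto simp: fun_eq_iff)
    moreover have "card (?S (Suc n)) = Suc (card (?S n))"
      using S True fin by simp
    ultimately show ?thesis by (simp only: piecewise_append[OF Suc f])
  next
    case False
    \<comment> \<open>Beyond the new grid point the old function already has the value sampled last,
      which equals the new one.\<close>
    have "grid_step f x v (Suc n) = grid_step f x v n"
    proof
      fix z
      show "grid_step f x v (Suc n) z = grid_step f x v n z"
      proof (cases "z \<le> x + real (Suc n) * v \<or> 1 \<le> x + real (Suc n) * v")
        case True
        then show ?thesis by auto
      next
        case z: False
        have "x + real n * v < x + real (Suc n) * v" using v by simp
        then have "grid_step f x v n z = f (x + real n * v)"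
          using z by (intro grid_step_last) linarith+
        then show ?thesis using z False by auto
      qed
    qed
    moreover have "?S (Suc n) = ?S n" unfolding S by (rule if_not_P[OF False])
    ultimately show ?thesis using Suc by (simp only:)
  qed
qed

lemma sum_grid_indicator_le:
  assumes "0 < v"
  shows "(\<Sum>i<n. indicator {real i * v<..real (Suc i) * v} y) \<le> (indicator {..real n * v} y :: ennreal)"
proof (induction n)
  case (Suc n)
  have "real n * v \<le> real (Suc n) * v" using assms by simp
  have "(\<Sum>i<Suc n. indicator {real i * v<..real (Suc i) * v} y)
      \<le> indicator {..real n * v} y + (indicator {real n * v<..real (Suc n) * v} y :: ennreal)"
    using Suc by (simp add: add_right_mono)
  also have "\<dots> \<le> indicator {..real (Suc n) * v} y"
    using \<open>real n * v \<le> real (Suc n) * v\<close> by (auto split: split_indicator)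
  finally show ?case .
qed simp

text \<open>The averaging device for the random offset: the translates of (0,v] by multiples of v
  are disjoint, so the sum over grid points, integrated over the offset, is an integral of \<phi>
  over part of the line.\<close>

lemma nn_integral_grid_le:
  assumes v: "0 < v" and [measurable]: "\<phi> \<in> borel_measurable borel"
  shows "(\<integral>\<^sup>+x\<in>{0<..v}. (\<Sum>i<n. \<phi> (x + real i * v)) \<partial>lborel) \<le> (\<integral>\<^sup>+y. \<phi> y \<partial>lborel)"
proof -
  have "(\<integral>\<^sup>+x\<in>{0<..v}. (\<Sum>i<n. \<phi> (x + real i * v)) \<partial>lborel)
      = (\<Sum>i<n. \<integral>\<^sup>+x. \<phi> (x + real i * v) * indicator {0<..v} x \<partial>lborel)"
    unfolding sum_distrib_right by (rule nn_integral_sum) measurable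
  also have "\<dots> = (\<Sum>i<n. \<integral>\<^sup>+y. \<phi> y * indicator {real i * v<..real (Suc i) * v} y \<partial>lborel)"
  proof (rule sum.cong[OF refl])
    fix i
    have "(\<integral>\<^sup>+y. \<phi> y * indicator {real i * v<..real (Suc i) * v} y \<partial>lborel)
        = (\<integral>\<^sup>+x. \<phi> (real i * v + 1 * x) * indicator {real i * v<..real (Suc i) * v} (real i * v + 1 * x) \<partial>lborel)"
      using nn_integral_real_affine[of "\<lambda>y. \<phi> y * indicator {real i * v<..real (Suc i) * v} y" 1 "real i * v"]
      by simp
    also have "\<dots> = (\<integral>\<^sup>+x. \<phi> (x + real i * v) * indicator {0<..v} x \<partial>lborel)"
      by (intro nn_integral_cong) (auto simp: algebra_simps split: split_indicator)
    finally show "(\<integral>\<^sup>+x. \<phi> (x + real i * v) * indicator {0<..v} x \<partial>lborel)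
        = (\<integral>\<^sup>+y. \<phi> y * indicator {real i * v<..real (Suc i) * v} y \<partial>lborel)" by simp
  qed
  also have "\<dots> = (\<integral>\<^sup>+y. \<phi> y * (\<Sum>i<n. indicator {real i * v<..real (Suc i) * v} y) \<partial>lborel)"
    unfolding sum_distrib_left by (rule nn_integral_sum[symmetric]) measurable
  also have "\<dots> \<le> (\<integral>\<^sup>+y. \<phi> y * 1 \<partial>lborel)"
    by (intro nn_integral_mono mult_left_mono order.trans[OF sum_grid_indicator_le[OF v]])
       (auto split: split_indicator)
  finally show ?thesis by simp
qed

lemma grid_cell_exists:
  assumes v: "0 < v" and z: "x < z"
  obtains i where "x + real i * v < z" "z \<le> x + real (Suc i) * v"
proof -
  \<comment> \<open>Cells are open on the left and closed on the right, hence the ceiling minus one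
    instead of the floor.\<close>
  define i where "i = nat (\<lceil>(z - x) / v\<rceil> - 1)"
  have "0 < (z - x) / v" using v z by simp
  then have "1 \<le> \<lceil>(z - x) / v\<rceil>" by linarith
  then have i: "real i = real_of_int \<lceil>(z - x) / v\<rceil> - 1" by (simp add: i_def)
  have "real i < (z - x) / v" "(z - x) / v \<le> real (Suc i)"
    using i by (simp_all) linarith+
  then show thesis using that[of i] v by (simp add: field_simps)
qed

text \<open>The part left of x contributes at most x. Any other point z of (0,1) lies in one of the
  first n cells, because n v \<ge> 1, and an error at z is a jump of length at most v starting at
  the left grid point of that cell.\<close>

lemma grid_step_error:
  assumes Y: "disagreement_measurable Y" and fm: "f \<in> borel \<rightarrow>\<^sub>M Y"
    and x: "0 < x" and v: "0 < v" and n: "1 \<le> real n * v"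
  shows "emeasure unif01 {z. f z \<noteq> grid_step f x v n z}
    \<le> ennreal x + (\<Sum>i<n. \<integral>\<^sup>+w\<in>{0..v}. jump f (x + real i * v) w \<partial>lborel)"
proof -
  define B where "B i = {z. f (x + real i * v) \<noteq> f z} \<inter> {x + real i * v..x + real (Suc i) * v} \<inter> {..<1}" for i
  have fY: "f z \<in> space Y" for z using measurable_space[OF fm, of z] by simp
  have B [measurable]: "B i \<in> sets borel" for i
  proof -
    have "{z. f (x + real i * v) \<noteq> f z} \<in> sets borel"
      using Y[unfolded disagreement_measurable_def, rule_format, of "\<lambda>_. f (x + real i * v)" f] fm fY
      by simp
    then show ?thesis unfolding B_def by measurable
  qed
  have G: "grid_step f x v n \<in> borel \<rightarrow>\<^sub>M Y"
    by (rule piecewise_class_measurable[OF grid_step_piecewise[OF fY v]])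
  have S: "{z. f z \<noteq> grid_step f x v n z} \<in> sets borel"
    using Y[unfolded disagreement_measurable_def, rule_format] fm G by simp
  have sub: "{0<..<1} \<inter> {z. f z \<noteq> grid_step f x v n z} \<subseteq> {0..x} \<union> (\<Union>i<n. B i)"
  proof (intro subsetI)
    fix z assume z: "z \<in> {0<..<1} \<inter> {z. f z \<noteq> grid_step f x v n z}"
    show "z \<in> {0..x} \<union> (\<Union>i<n. B i)"
    proof (cases "z \<le> x")
      case False
      then obtain i where i: "x + real i * v < z" "z \<le> x + real (Suc i) * v"
        using grid_cell_exists[OF v, of x z] by auto
      have "real i * v < real n * v" using i z n x by auto
      then have "i < n" using v by simp
      moreover have "f z \<noteq> f (x + real i * v)"
        using grid_step_eq[OF v i, of n f] \<open>i < n\<close> z by auto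
      ultimately have "z \<in> B i" using i z by (auto simp: B_def)
      then show ?thesis using \<open>i < n\<close> by blast
    qed (use z in auto)
  qed
  have "emeasure lborel (B i) \<le> (\<integral>\<^sup>+w\<in>{0..v}. jump f (x + real i * v) w \<partial>lborel)" for i
  proof -
    have "emeasure lborel (B i) = (\<integral>\<^sup>+z. indicator (B i) z \<partial>lborel)" by simp
    also have "\<dots> = (\<integral>\<^sup>+w. indicator (B i) ((x + real i * v) + 1 * w) \<partial>lborel)"
      by (subst nn_integral_real_affine[of _ 1 "x + real i * v"]) auto
    also have "\<dots> \<le> (\<integral>\<^sup>+w\<in>{0..v}. jump f (x + real i * v) w \<partial>lborel)"
    proof (rule nn_integral_mono)
      fix w
      have "0 < x + real i * v" using x v by (simp add: add_pos_nonneg)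
      then show "indicator (B i) ((x + real i * v) + 1 * w) \<le> jump f (x + real i * v) w * indicator {0..v} w"
        by (auto simp: B_def jump_def algebra_simps split: split_indicator)
    qed
    finally show ?thesis .
  qed
  then have "emeasure lborel ({0..x} \<union> (\<Union>i<n. B i))
      \<le> ennreal x + (\<Sum>i<n. \<integral>\<^sup>+w\<in>{0..v}. jump f (x + real i * v) w \<partial>lborel)"
    using x
    by (intro order.trans[OF emeasure_subadditive] add_mono
          order.trans[OF emeasure_subadditive_finite] sum_mono) auto
  then show ?thesis
    unfolding emeasure_unif01[OF S]
    by (rule order.trans[OF emeasure_mono[OF sub], rotated]) measurable
qed

lemma far_from_class:
  assumes "class_dist f F \<ge> \<epsilon>" "g \<in> F"
  shows "\<epsilon> \<le> fdist f g"
proof -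
  have "class_dist f F \<le> fdist f g"
    unfolding class_dist_def
    by (rule cINF_lower[OF _ assms(2)]) (auto intro!: bdd_belowI[of _ 0] simp: fdist_def)
  then show ?thesis using assms(1) by simp
qed

text \<open>A grid either approximates \<open>f\<close> badly, or its step function has too many jumps: otherwise
  merging its shortest pieces would bring \<open>f\<close> close to the class.\<close>

lemma grid_jumps_or_error:
  assumes Y: "disagreement_measurable Y" and fm: "f \<in> borel \<rightarrow>\<^sub>M Y"
    and x: "0 < x" and v: "0 < v" and n: "1 \<le> real n * v" and k: "k \<ge> 1" and \<epsilon>: "0 < \<epsilon>"
    and far: "class_dist f (piecewise_class k (constant_functions Y)) \<ge> \<epsilon>"
  defines "err \<equiv> ennreal x + (\<Sum>i<n. \<integral>\<^sup>+w\<in>{0..v}. jump f (x + real i * v) w \<partial>lborel)"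
  shows "ennreal (\<epsilon> / 2) \<le> err \<or>
    ennreal (real k - 1 + real k * \<epsilon> / 2) \<le> (\<Sum>i<n. jump f (x + real i * v) v)"
proof (cases "ennreal (\<epsilon> / 2) \<le> err")
  case False
  then have "emeasure unif01 {z. f z \<noteq> grid_step f x v n z} < ennreal (\<epsilon> / 2)"
    using grid_step_error[OF Y fm x v n] unfolding err_def by simp
  then have d1: "fdist f (grid_step f x v n) < \<epsilon> / 2"
    unfolding fdist_def unif01.emeasure_eq_measure using \<epsilon> by (simp add: ennreal_less_iff)
  have fY: "f z \<in> space Y" for z using measurable_space[OF fm, of z] by simp
  define S where
    "S = {i. i < n \<and> x + real (Suc i) * v < 1 \<and> f (x + real i * v) \<noteq> f (x + real (Suc i) * v)}"
  \<comment> \<open>The number of surplus pieces. The subtraction is truncated, so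
    \<open>m = 0\<close> also covers step functions with fewer than k pieces; the distance bound
    excludes that case below.\<close>
  define m where "m = Suc (card S) - k"
  have "grid_step f x v n \<in> piecewise_class (Suc (card S)) (constant_functions Y)"
    unfolding S_def by (rule grid_step_piecewise[OF fY v])
  then have G: "grid_step f x v n \<in> piecewise_class (k + m) (constant_functions Y)"
    by (rule piecewise_class_mono) (simp add: m_def)
  obtain g where g: "g \<in> piecewise_class k (constant_functions Y)"
      "fdist (grid_step f x v n) g \<le> real m / real k"
    by (rule piecewise_merge_many[OF Y k G])
  have "\<epsilon> \<le> fdist f g" by (rule far_from_class[OF far g(1)])
  also have "\<dots> \<le> fdist f (grid_step f x v n) + fdist (grid_step f x v n) g"
    using piecewise_class_measurable G g(1) fm by (intro fdist_triangle[OF Y]) blast+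
  finally have "\<epsilon> / 2 < real m / real k" using d1 g(2) by linarith
  then have m: "real k * \<epsilon> / 2 < real m" using k by (simp add: field_simps)
  then have "m > 0" using k \<epsilon> by (cases m) (auto simp: field_simps mult_less_0_iff)
  then have "real (card S) = real k - 1 + real m" unfolding m_def by linarith
  then have "ennreal (real k - 1 + real k * \<epsilon> / 2) \<le> ennreal (real (card S))"
    using m by (intro ennreal_leI) simp
  also have "\<dots> = of_nat (card S)" by (simp add: ennreal_of_nat_eq_real_of_nat)
  also have "\<dots> = (\<Sum>i<n. of_bool (i \<in> S))"
    by (simp add: S_def of_bool_def sum.If_cases Int_def)
  also have "\<dots> = (\<Sum>i<n. jump f (x + real i * v) v)"
  proof (rule sum.cong[OF refl])
    fix i assume "i \<in> {..<n}"
    moreover have "0 < x + real i * v" using x v by (simp add: add_pos_nonneg)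
    ultimately show "of_bool (i \<in> S) = jump f (x + real i * v) v"
      by (simp add: S_def jump_def algebra_simps)
  qed
  finally show ?thesis ..
qed simp

text \<open>By contradiction. A small integral yields a shift with small noise, subadditivity
  transfers it to a shift v comparable to u, and \<open>grid_jumps_or_error\<close> is averaged over
  all offsets in (0,v]. The expected number of jumps then falls short by an amount that the
  approximation error cannot make up.\<close>

lemma noise_integral_ge_of_far:
  assumes Y: "disagreement_measurable Y" and fm: "f \<in> borel \<rightarrow>\<^sub>M Y" and k: "k \<ge> 1"
    and \<epsilon>: "0 < \<epsilon>" "\<epsilon> < 1 / 2" and u: "u = \<epsilon>\<^sup>2 / (64 * real k)"
    and far: "class_dist f (piecewise_class k (constant_functions Y)) \<ge> \<epsilon>"
  shows "ennreal (u\<^sup>2 / 2 * (real k - 1 + real k * \<epsilon> / 4)) \<le> (\<integral>\<^sup>+w\<in>{0..u}. noise f w \<partial>lborel)"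
proof (rule ccontr)
  assume contr: "\<not> ?thesis"
  define \<kappa> where "\<kappa> = real k - 1 + real k * \<epsilon> / 4"
  define L where "L = real k - 1 + real k * \<epsilon> / 2"
  have upos: "0 < u" using u \<epsilon> k by simp
  have \<kappa>: "0 < \<kappa>" "\<kappa> \<le> 9 / 8 * real k"
  proof -
    have "0 < real k * \<epsilon> / 4" using k \<epsilon> by simp
    moreover have "real k * \<epsilon> \<le> real k * (1 / 2)" using \<epsilon> by (intro mult_left_mono) auto
    ultimately show "0 < \<kappa>" "\<kappa> \<le> 9 / 8 * real k" using k unfolding \<kappa>_def by linarith+
  qed
  have L: "0 < L" "L \<le> 5 / 4 * real k"
  proof -
    have "0 < real k * \<epsilon> / 2" using k \<epsilon> by simp
    moreover have "real k * \<epsilon> \<le> real k * (1 / 2)" using \<epsilon> by (intro mult_left_mono) auto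
    ultimately show "0 < L" "L \<le> 5 / 4 * real k" using k unfolding L_def by linarith+
  qed
  note pairs = disagreement_pairs_measurable[OF Y fm]
  note [measurable] = noise_measurable[OF pairs]
  note [measurable (raw)] = jump_measurable_compose[OF pairs]
  \<comment> \<open>Were the noise at least \<kappa> w throughout, its integral would reach \<kappa>
    u^2/2.\<close>
  have "\<exists>w\<in>{0..u}. noise f w < ennreal (\<kappa> * w)"
  proof (rule ccontr)
    assume "\<not> ?thesis"
    then have "(\<integral>\<^sup>+w\<in>{0..u}. ennreal (\<kappa> * w) \<partial>lborel) \<le> (\<integral>\<^sup>+w\<in>{0..u}. noise f w \<partial>lborel)"
      by (intro nn_integral_mono) (auto split: split_indicator simp: not_less)
    then show False
      using contr nn_integral_linear_Icc[of \<kappa> u] \<kappa> upos by (simp add: \<kappa>_def)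
  qed
  then obtain w where w: "w \<in> {0..u}" "noise f w < ennreal (\<kappa> * w)" by blast
  then have wpos: "0 < w" by (cases "w = 0") auto
  \<comment> \<open>The witness w may be tiny, so it is replaced by its largest multiple v = m w not
    exceeding u. This keeps the linear bound and satisfies v \<ge> u/2, which lets the integral up
    to u be bounded in terms of v.\<close>
  define m where "m = nat \<lfloor>u / w\<rfloor>"
  have "1 \<le> u / w" using w wpos by simp
  then have "real m = real_of_int \<lfloor>u / w\<rfloor>" "1 \<le> \<lfloor>u / w\<rfloor>" by (simp_all add: m_def)
  then have m: "1 \<le> real m" "real m \<le> u / w" "u / w < real m + 1" by linarith+
  define v where "v = real m * w"
  have v: "0 < v" "v \<le> u" "u / 2 \<le> v"
  proof -
    show "0 < v" using m(1) wpos by (simp add: v_def)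
    show "v \<le> u" using m(2) wpos by (simp add: v_def field_simps)
    have "u < (real m + 1) * w" using m(3) wpos by (simp add: field_simps)
    also have "\<dots> \<le> (2 * real m) * w" using m(1) wpos by (intro mult_right_mono) auto
    finally show "u / 2 \<le> v" by (simp add: v_def)
  qed
  have Dv: "noise f v \<le> ennreal (\<kappa> * v)"
  proof -
    have "noise f v \<le> of_nat m * noise f w"
      unfolding v_def by (rule noise_mult_le[OF pairs]) (use wpos in simp)
    also have "\<dots> \<le> of_nat m * ennreal (\<kappa> * w)" using w(2) by (intro mult_left_mono) auto
    also have "\<dots> = ennreal (\<kappa> * v)"
      using \<kappa> wpos unfolding v_def ennreal_of_nat_eq_real_of_nat
      by (subst ennreal_mult[symmetric]) (auto simp: algebra_simps)
    finally show ?thesis .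
  qed
  have Iv: "(\<integral>\<^sup>+w\<in>{0..v}. noise f w \<partial>lborel) \<le> ennreal (u * \<kappa> * v)"
  proof -
    have "(\<integral>\<^sup>+w\<in>{0..v}. noise f w \<partial>lborel) \<le> (\<integral>\<^sup>+w\<in>{0..u}. noise f w \<partial>lborel)"
      using v(2) by (intro nn_integral_mono) (auto split: split_indicator)
    also have "\<dots> \<le> ennreal (u\<^sup>2 / 2 * \<kappa>)" using contr by (simp add: \<kappa>_def)
    also have "\<dots> \<le> ennreal (u * \<kappa> * v)"
    proof (rule ennreal_leI)
      have "u * \<kappa> * (u / 2) \<le> u * \<kappa> * v" using v(3) upos \<kappa> by (intro mult_left_mono) auto
      then show "u\<^sup>2 / 2 * \<kappa> \<le> u * \<kappa> * v" by (simp add: power2_eq_square algebra_simps)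
    qed
    finally show ?thesis .
  qed
  define n where "n = nat \<lceil>1 / v\<rceil>"
  have n: "1 \<le> real n * v"
  proof -
    have "1 / v \<le> real n" unfolding n_def using v(1) by (simp add: of_nat_ceiling)
    then show ?thesis using v(1) by (simp add: field_simps)
  qed
  define R where "R y = (\<integral>\<^sup>+w\<in>{0..v}. jump f y w \<partial>lborel)" for y
  \<comment> \<open>With this weight an error of \<epsilon>/2 counts as much as L jumps, so the
    alternative between error and jumps becomes a single inequality that can be integrated.\<close>
  define C where "C = 2 * L / \<epsilon>"
  define c where "c = ennreal C"
  have C: "0 \<le> C" using L \<epsilon> by (simp add: C_def)
  have R [measurable]: "R \<in> borel_measurable borel" unfolding R_def by measurable
  have J: "(\<lambda>y. jump f y v) \<in> borel_measurable borel" by measurable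
  have pointwise: "ennreal L \<le> (\<Sum>i<n. jump f (x + real i * v) v) + (c * ennreal v + c * (\<Sum>i<n. R (x + real i * v)))"
    if x: "x \<in> {0<..v}" for x
  proof -
    have "ennreal (\<epsilon> / 2) \<le> ennreal x + (\<Sum>i<n. R (x + real i * v)) \<or>
        ennreal L \<le> (\<Sum>i<n. jump f (x + real i * v) v)"
      unfolding R_def L_def using x by (intro grid_jumps_or_error[OF Y fm _ v(1) n k \<epsilon>(1) far]) auto
    then show ?thesis
    proof
      assume *: "ennreal (\<epsilon> / 2) \<le> ennreal x + (\<Sum>i<n. R (x + real i * v))"
      have "ennreal L = c * ennreal (\<epsilon> / 2)"
        using L \<epsilon> unfolding c_def C_def by (subst ennreal_mult[symmetric]) auto
      also have "\<dots> \<le> c * (ennreal v + (\<Sum>i<n. R (x + real i * v)))"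
        using x by (intro mult_left_mono order.trans[OF *] add_right_mono ennreal_leI) auto
      finally show ?thesis by (simp add: distrib_left add_increasing)
    qed (simp add: add_increasing2)
  qed
  have "ennreal L * ennreal v = (\<integral>\<^sup>+x\<in>{0<..v}. ennreal L \<partial>lborel)"
    using v(1) by (simp add: nn_integral_cmult_indicator)
  also have "\<dots> \<le> (\<integral>\<^sup>+x. (\<Sum>i<n. jump f (x + real i * v) v) * indicator {0<..v} x
      + (c * ennreal v * indicator {0<..v} x + c * ((\<Sum>i<n. R (x + real i * v)) * indicator {0<..v} x)) \<partial>lborel)"
    using pointwise by (intro nn_integral_mono) (auto split: split_indicator)
  also have "\<dots> = (\<integral>\<^sup>+x\<in>{0<..v}. (\<Sum>i<n. jump f (x + real i * v) v) \<partial>lborel)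
      + (c * ennreal v * ennreal v + c * (\<integral>\<^sup>+x\<in>{0<..v}. (\<Sum>i<n. R (x + real i * v)) \<partial>lborel))"
    using v(1) by (simp add: nn_integral_add nn_integral_cmult nn_integral_cmult_indicator)
  also have "\<dots> \<le> noise f v + (c * ennreal v * ennreal v + c * (\<integral>\<^sup>+y. R y \<partial>lborel))"
    unfolding noise_def
    by (intro add_mono mult_left_mono nn_integral_grid_le[OF v(1)] order.refl R J) auto
  \<comment> \<open>Tonelli turns the accumulated error of the cells into the integral of the noise
    over shifts up to v.\<close>
  also have "(\<integral>\<^sup>+y. R y \<partial>lborel) = (\<integral>\<^sup>+w\<in>{0..v}. noise f w \<partial>lborel)"
  proof -
    have "(\<integral>\<^sup>+y. R y \<partial>lborel) = (\<integral>\<^sup>+w. \<integral>\<^sup>+y. jump f y w * indicator {0..v} w \<partial>lborel \<partial>lborel)"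
      unfolding R_def by (rule lborel_pair.Fubini'[symmetric]) measurable
    then show ?thesis unfolding noise_def by (simp add: nn_integral_multc)
  qed
  also have "noise f v + (c * ennreal v * ennreal v + c * (\<integral>\<^sup>+w\<in>{0..v}. noise f w \<partial>lborel))
      \<le> ennreal (\<kappa> * v) + (c * ennreal v * ennreal u + c * ennreal (u * \<kappa> * v))"
    using v(2) by (intro add_mono mult_left_mono Dv Iv ennreal_leI) auto
  also have "\<dots> = ennreal (\<kappa> * v + (C * v * u + C * (u * \<kappa> * v)))"
    using C \<kappa> v upos unfolding c_def by (simp flip: ennreal_mult ennreal_plus)
  finally have "ennreal (L * v) \<le> ennreal (\<kappa> * v + (C * v * u + C * (u * \<kappa> * v)))"
    using L v by (simp add: ennreal_mult)
  then have "L * v \<le> \<kappa> * v + (C * v * u + C * (u * \<kappa> * v))"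
    using C \<kappa> v upos by (subst (asm) ennreal_le_iff) auto
  then have "L * v \<le> (\<kappa> + C * (u + u * \<kappa>)) * v" by (simp add: algebra_simps)
  then have 1: "L \<le> \<kappa> + 2 * L / \<epsilon> * (u + u * \<kappa>)" using v(1) by (simp add: C_def)
  \<comment> \<open>The gap L - \<kappa> is k \<epsilon>/4, and the factor 64 in u makes the error
    term only 85/1024 of k \<epsilon>.\<close>
  have "2 * L / \<epsilon> * (u + u * \<kappa>) \<le> 2 * (5 / 4 * real k) / \<epsilon> * (u * real k + u * (9 / 8 * real k))"
    using L \<kappa> upos \<epsilon> k by (intro mult_mono divide_right_mono add_mono mult_left_mono) auto
  also have "\<dots> = 85 / 1024 * (real k * \<epsilon>)"
    using k \<epsilon> unfolding u by (simp add: field_simps power2_eq_square)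
  also have "\<dots> < 1 / 4 * (real k * \<epsilon>)" using k \<epsilon> by (intro mult_strict_right_mono) auto
  finally show False using 1 unfolding L_def \<kappa>_def by linarith
qed

section \<open>Counting pairs in a random sample\<close>

text \<open>Redrawing coordinate i does not change the distribution. The inner integral plays the
  part of a conditional expectation given the other coordinates, while the index set stays
  I.\<close>

lemma nn_integral_PiM_resample:
  assumes M: "prob_space M" and I: "finite I" "i \<in> I"
    and F [measurable]: "F \<in> borel_measurable (\<Pi>\<^sub>M i\<in>I. M)"
  shows "(\<integral>\<^sup>+x. F x \<partial>(\<Pi>\<^sub>M i\<in>I. M)) = (\<integral>\<^sup>+x. \<integral>\<^sup>+y. F (x(i := y)) \<partial>M \<partial>(\<Pi>\<^sub>M i\<in>I. M))"
proof -
  interpret M: prob_space M by fact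
  interpret product_prob_space "\<lambda>_. M" by standard
  define J where "J = I - {i}"
  have J: "finite J" "i \<notin> J" "I = insert i J" using I by (auto simp: J_def)
  have upd [measurable]: "(\<lambda>(x, y). x(i := y)) \<in> (\<Pi>\<^sub>M i\<in>I. M) \<Otimes>\<^sub>M M \<rightarrow>\<^sub>M (\<Pi>\<^sub>M i\<in>I. M)"
    using measurable_add_dim[of i I "\<lambda>_. M"] I(2) by (simp add: insert_absorb)
  have "(\<lambda>(x, y). F (x(i := y))) \<in> borel_measurable ((\<Pi>\<^sub>M i\<in>I. M) \<Otimes>\<^sub>M M)"
    using measurable_compose[OF upd F] by (simp add: case_prod_beta')
  then have G: "(\<lambda>x. \<integral>\<^sup>+y. F (x(i := y)) \<partial>M) \<in> borel_measurable (\<Pi>\<^sub>M i\<in>I. M)"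
    by (rule M.borel_measurable_nn_integral)
  have "(\<integral>\<^sup>+x. \<integral>\<^sup>+y. F (x(i := y)) \<partial>M \<partial>(\<Pi>\<^sub>M i\<in>I. M))
      = (\<integral>\<^sup>+x. \<integral>\<^sup>+z. \<integral>\<^sup>+y. F (x(i := y)) \<partial>M \<partial>M \<partial>(\<Pi>\<^sub>M i\<in>J. M))"
    using product_nn_integral_insert[OF J(1,2), of "\<lambda>x. \<integral>\<^sup>+y. F (x(i := y)) \<partial>M"] G J(3) by simp
  also have "\<dots> = (\<integral>\<^sup>+x. F x \<partial>(\<Pi>\<^sub>M i\<in>I. M))"
    using product_nn_integral_insert[OF J(1,2), of F] F J(3) by (simp add: M.emeasure_space_1)
  finally show ?thesis ..
qed

context
  fixes M :: "'a measure" and I :: "nat set"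
  assumes M: "prob_space M" and I: "finite I"
begin

lemma measurable_PiM_pair [measurable (raw)]:
  assumes "i \<in> I" "j \<in> I" "g \<in> borel_measurable (M \<Otimes>\<^sub>M M)"
  shows "(\<lambda>x. g (x i, x j)) \<in> borel_measurable (\<Pi>\<^sub>M i\<in>I. M)"
  by (rule measurable_compose[OF _ assms(3)]) (use assms(1,2) in measurable)

text \<open>Coordinates i and j are redrawn one after the other. Since h is invariant under changing
  either of them, it passes through both inner integrals.\<close>

lemma nn_integral_PiM_pair_indep:
  assumes ij: "i \<in> I" "j \<in> I" "i \<noteq> j"
    and h [measurable]: "h \<in> borel_measurable (\<Pi>\<^sub>M i\<in>I. M)"
    and hi: "\<And>x y. h (x(i := y)) = h x" and hj: "\<And>x y. h (x(j := y)) = h x"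
    and g [measurable]: "g \<in> borel_measurable (M \<Otimes>\<^sub>M M)"
  shows "(\<integral>\<^sup>+x. h x * g (x i, x j) \<partial>(\<Pi>\<^sub>M i\<in>I. M))
    = (\<integral>\<^sup>+x. h x \<partial>(\<Pi>\<^sub>M i\<in>I. M)) * (\<integral>\<^sup>+b. \<integral>\<^sup>+a. g (a, b) \<partial>M \<partial>M)"
proof -
  interpret M: prob_space M by fact
  interpret product_prob_space "\<lambda>_. M" by standard
  have g1: "(\<lambda>a. g (a, b)) \<in> borel_measurable M" if "b \<in> space M" for b using that by measurable
  have g2 [measurable]: "(\<lambda>b. \<integral>\<^sup>+a. g (a, b) \<partial>M) \<in> borel_measurable M"
    by measurable
  have g3 [measurable]: "(\<lambda>x. \<integral>\<^sup>+a. g (a, x j) \<partial>M) \<in> borel_measurable (\<Pi>\<^sub>M i\<in>I. M)"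
    by (rule measurable_compose[OF _ g2]) (use ij in measurable)
  have "(\<integral>\<^sup>+x. h x * g (x i, x j) \<partial>(\<Pi>\<^sub>M i\<in>I. M))
      = (\<integral>\<^sup>+x. \<integral>\<^sup>+a. h x * g (a, x j) \<partial>M \<partial>(\<Pi>\<^sub>M i\<in>I. M))"
    using ij by (subst nn_integral_PiM_resample[OF M I ij(1)]) (auto simp: hi)
  also have "\<dots> = (\<integral>\<^sup>+x. h x * (\<integral>\<^sup>+a. g (a, x j) \<partial>M) \<partial>(\<Pi>\<^sub>M i\<in>I. M))"
    by (intro nn_integral_cong nn_integral_cmult g1) (use ij in \<open>auto simp: space_PiM PiE_def\<close>)
  also have "\<dots> = (\<integral>\<^sup>+x. \<integral>\<^sup>+b. h x * (\<integral>\<^sup>+a. g (a, b) \<partial>M) \<partial>M \<partial>(\<Pi>\<^sub>M i\<in>I. M))"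
    using ij by (subst nn_integral_PiM_resample[OF M I ij(2)]) (auto simp: hj)
  also have "\<dots> = (\<integral>\<^sup>+x. h x * (\<integral>\<^sup>+b. \<integral>\<^sup>+a. g (a, b) \<partial>M \<partial>M) \<partial>(\<Pi>\<^sub>M i\<in>I. M))"
    by (intro nn_integral_cong nn_integral_cmult g2)
  also have "\<dots> = (\<integral>\<^sup>+x. h x \<partial>(\<Pi>\<^sub>M i\<in>I. M)) * (\<integral>\<^sup>+b. \<integral>\<^sup>+a. g (a, b) \<partial>M \<partial>M)"
    by (rule nn_integral_multc) measurable
  finally show ?thesis .
qed

text \<open>Redrawing coordinate l averages g alone, because h ignores that coordinate; the uniform
  bound c on this average then factors out.\<close>

lemma nn_integral_PiM_resample_le:
  assumes l: "l \<in> I"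
    and h [measurable]: "h \<in> borel_measurable (\<Pi>\<^sub>M i\<in>I. M)" and hl: "\<And>x y. h (x(l := y)) = h x"
    and g [measurable]: "g \<in> borel_measurable (\<Pi>\<^sub>M i\<in>I. M)"
    and c: "\<And>x. x \<in> space (\<Pi>\<^sub>M i\<in>I. M) \<Longrightarrow> (\<integral>\<^sup>+y. g (x(l := y)) \<partial>M) \<le> c"
  shows "(\<integral>\<^sup>+x. h x * g x \<partial>(\<Pi>\<^sub>M i\<in>I. M)) \<le> (\<integral>\<^sup>+x. h x \<partial>(\<Pi>\<^sub>M i\<in>I. M)) * c"
proof -
  have "(\<integral>\<^sup>+x. h x * g x \<partial>(\<Pi>\<^sub>M i\<in>I. M)) = (\<integral>\<^sup>+x. \<integral>\<^sup>+y. h x * g (x(l := y)) \<partial>M \<partial>(\<Pi>\<^sub>M i\<in>I. M))"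
    by (subst nn_integral_PiM_resample[OF M I l]) (auto simp: hl)
  also have "\<dots> = (\<integral>\<^sup>+x. h x * (\<integral>\<^sup>+y. g (x(l := y)) \<partial>M) \<partial>(\<Pi>\<^sub>M i\<in>I. M))"
  proof (intro nn_integral_cong nn_integral_cmult)
    fix x assume x: "x \<in> space (\<Pi>\<^sub>M i\<in>I. M)"
    have "(\<lambda>y. if i = l then y else x i) \<in> M \<rightarrow>\<^sub>M M" if "i \<in> I" for i
      using x that by (cases "i = l") (auto simp: space_PiM PiE_def dest: funcset_mem)
    then have "(\<lambda>y. x(l := y)) \<in> M \<rightarrow>\<^sub>M (\<Pi>\<^sub>M i\<in>I. M)"
      using x l by (intro measurable_PiM_single') (auto simp: space_PiM PiE_def extensional_def fun_upd_def)
    then show "(\<lambda>y. g (x(l := y))) \<in> borel_measurable M"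
      by (rule measurable_compose[OF _ g])
  qed
  also have "\<dots> \<le> (\<integral>\<^sup>+x. h x * c \<partial>(\<Pi>\<^sub>M i\<in>I. M))"
    by (intro nn_integral_mono mult_left_mono c) auto
  also have "\<dots> = (\<integral>\<^sup>+x. h x \<partial>(\<Pi>\<^sub>M i\<in>I. M)) * c"
    by (rule nn_integral_multc) measurable
  finally show ?thesis .
qed

end

text \<open>First indices stop at n while second indices may run up to n + d - 1, so every first
  index has exactly d partners and the number of pairs is exactly n d.\<close>

definition band :: "nat \<Rightarrow> nat \<Rightarrow> (nat \<times> nat) set" where
  "band n d = (SIGMA i:{..<n}. {i<..i + d})"

definition hits :: "('a \<times> 'a) set \<Rightarrow> nat \<Rightarrow> nat \<Rightarrow> (nat \<Rightarrow> 'a) \<Rightarrow> real" where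
  "hits B n d x = (\<Sum>e\<in>band n d. indicator B (x (fst e), x (snd e)))"

lemma ennreal_hits: "ennreal (hits B n d x) = (\<Sum>e\<in>band n d. indicator B (x (fst e), x (snd e)))"
  unfolding hits_def by (subst sum_ennreal[symmetric]) (simp_all add: ennreal_indicator)

lemma finite_band [simp]: "finite (band n d)"
  by (simp add: band_def)

lemma card_band [simp]: "card (band n d) = n * d"
  by (simp add: band_def card_SigmaI)

text \<open>A given index is the smaller member of at most d pairs and the larger member of at most
  d pairs; two indices give 4 d.\<close>

lemma card_band_adjacent:
  "card {e' \<in> band n d. {fst e', snd e'} \<inter> {i, j} \<noteq> {}} \<le> 4 * d"
proof -
  let ?N = "\<lambda>i. {i} \<times> {i<..i + d} \<union> {i - d..<i} \<times> {i}"
  have N: "card (?N i) \<le> 2 * d" for i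
  proof -
    have "card (?N i) \<le> card ({i} \<times> {i<..i + d}) + card ({i - d..<i} \<times> {i})"
      by (rule card_Un_le)
    also have "\<dots> \<le> 2 * d" by (simp add: card_cartesian_product)
    finally show ?thesis .
  qed
  have "card {e' \<in> band n d. {fst e', snd e'} \<inter> {i, j} \<noteq> {}} \<le> card (?N i \<union> ?N j)"
    by (rule card_mono) (auto simp: band_def)
  also have "\<dots> \<le> 4 * d" using N[of i] N[of j] card_Un_le[of "?N i" "?N j"] by linarith
  finally show ?thesis .
qed

section \<open>Mean and variance of the number of hits in the band\<close>

context
  fixes M :: "'a measure" and B :: "('a \<times> 'a) set" and n d :: nat and p u :: real
  assumes M: "prob_space M" and B [measurable]: "B \<in> sets (M \<Otimes>\<^sub>M M)"
    and p: "(\<integral>\<^sup>+b. \<integral>\<^sup>+a. indicator B (a, b) \<partial>M \<partial>M) = ennreal p" "0 \<le> p"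
    and u1: "\<And>b. b \<in> space M \<Longrightarrow> (\<integral>\<^sup>+a. indicator B (a, b) \<partial>M) \<le> ennreal u"
    and u2: "\<And>a. a \<in> space M \<Longrightarrow> (\<integral>\<^sup>+b. indicator B (a, b) \<partial>M) \<le> ennreal u"
    and u: "0 \<le> u"
begin

abbreviation "sample \<equiv> (\<Pi>\<^sub>M i\<in>{..<n + d}. M)"

abbreviation "hit e x \<equiv> indicator B (x (fst e), x (snd e))"

lemma prob_space_sample: "prob_space sample"
  by (rule prob_space_PiM[OF M])

lemma hit_measurable [measurable]:
  "e \<in> band n d \<Longrightarrow> (\<lambda>x. hit e x :: ennreal) \<in> borel_measurable sample"
  "e \<in> band n d \<Longrightarrow> (\<lambda>x. hit e x :: real) \<in> borel_measurable sample"
  by (auto simp: band_def intro!: measurable_PiM_pair[OF M])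

lemma nn_integral_hit:
  assumes "e \<in> band n d"
  shows "(\<integral>\<^sup>+x. hit e x \<partial>sample) = ennreal p"
  using nn_integral_PiM_pair_indep[OF M, of "{..<n + d}" "fst e" "snd e" "\<lambda>_. 1" "indicator B"] assms
  by (auto simp: band_def p prob_space.emeasure_space_1[OF prob_space_sample])

text \<open>Disjoint pairs are independent and give p^2. If exactly one index is shared, redrawing
  the other index of \<open>e'\<close> hits with conditional probability at most u, which gives u p.
  Equal pairs give p.\<close>

lemma nn_integral_hit_hit:
  assumes e: "e \<in> band n d" and e': "e' \<in> band n d"
  shows "(\<integral>\<^sup>+x. hit e x * hit e' x \<partial>sample) \<le> ennreal (p\<^sup>2
    + of_bool ({fst e', snd e'} \<inter> {fst e, snd e} \<noteq> {}) * (u * p) + of_bool (e' = e) * p)"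
proof -
  have adjacent: ?thesis if "(\<integral>\<^sup>+x. hit e x * hit e' x \<partial>sample) \<le> (\<integral>\<^sup>+x. hit e x \<partial>sample) * ennreal u"
    and adj: "{fst e', snd e'} \<inter> {fst e, snd e} \<noteq> {}"
  proof -
    note that(1)
    also have "(\<integral>\<^sup>+x. hit e x \<partial>sample) * ennreal u = ennreal (p * u)"
      using nn_integral_hit[OF e] p u by (simp add: ennreal_mult)
    also have "\<dots> \<le> ennreal (p\<^sup>2
      + of_bool ({fst e', snd e'} \<inter> {fst e, snd e} \<noteq> {}) * (u * p) + of_bool (e' = e) * p)"
      unfolding eqTrueI[OF adj] using u p by (intro ennreal_leI) (simp add: mult.commute)
    finally show ?thesis .
  qed
  have "fst e < snd e" "fst e' < snd e'" using e e' by (auto simp: band_def)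
  \<comment> \<open>Both pairs are increasing, so two different pairs cannot have both indices in
    common.\<close>
  then have "e' = e \<or> {fst e', snd e'} \<inter> {fst e, snd e} = {}
    \<or> fst e' \<notin> {fst e, snd e} \<and> snd e' \<in> {fst e, snd e}
    \<or> snd e' \<notin> {fst e, snd e} \<and> fst e' \<in> {fst e, snd e}"
    by (cases e; cases e') auto
  then consider "e' = e" | "{fst e', snd e'} \<inter> {fst e, snd e} = {}"
    | "fst e' \<notin> {fst e, snd e}" "snd e' \<in> {fst e, snd e}"
    | "snd e' \<notin> {fst e, snd e}" "fst e' \<in> {fst e, snd e}"
    by blast
  then show ?thesis
  proof cases
    case 1
    have "(\<integral>\<^sup>+x. hit e x * hit e x \<partial>sample) = (\<integral>\<^sup>+x. hit e x \<partial>sample)"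
      by (intro nn_integral_cong) (auto split: split_indicator)
    then show ?thesis using 1 nn_integral_hit[OF e] u p by (auto intro!: ennreal_leI)
  next
    case 2
    have "(\<integral>\<^sup>+x. hit e x * hit e' x \<partial>sample) = (\<integral>\<^sup>+x. hit e x \<partial>sample) * ennreal p"
      using nn_integral_PiM_pair_indep[OF M, of "{..<n + d}" "fst e'" "snd e'" "hit e" "indicator B"] e e' 2
      by (auto simp: band_def p)
    also have "\<dots> = ennreal (p\<^sup>2)"
      using nn_integral_hit[OF e] p by (simp add: ennreal_mult power2_eq_square)
    also have "\<dots> \<le> ennreal (p\<^sup>2
      + of_bool ({fst e', snd e'} \<inter> {fst e, snd e} \<noteq> {}) * (u * p) + of_bool (e' = e) * p)"
      using u p by (intro ennreal_leI) auto
    finally show ?thesis .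
  next
    case 3
    have "(\<integral>\<^sup>+x. hit e x * hit e' x \<partial>sample) \<le> (\<integral>\<^sup>+x. hit e x \<partial>sample) * ennreal u"
    proof (rule nn_integral_PiM_resample_le[OF M, where l = "fst e'"])
      fix x assume "x \<in> space sample"
      then have "x (snd e') \<in> space M" using e' by (auto simp: space_PiM PiE_def band_def)
      then show "(\<integral>\<^sup>+y. hit e' (x(fst e' := y)) \<partial>M) \<le> ennreal u"
        using u1 3 e' by (auto simp: band_def)
    qed (use 3 e e' in \<open>auto simp: band_def intro!: hit_measurable\<close>)
    then show ?thesis using 3 by (intro adjacent) auto
  next
    case 4
    have "(\<integral>\<^sup>+x. hit e x * hit e' x \<partial>sample) \<le> (\<integral>\<^sup>+x. hit e x \<partial>sample) * ennreal u"
    proof (rule nn_integral_PiM_resample_le[OF M, where l = "snd e'"])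
      fix x assume "x \<in> space sample"
      then have "x (fst e') \<in> space M" using e' by (auto simp: space_PiM PiE_def band_def)
      then show "(\<integral>\<^sup>+y. hit e' (x(snd e' := y)) \<partial>M) \<le> ennreal u"
        using u2 4 e' by (auto simp: band_def)
    qed (use 4 e e' in \<open>auto simp: band_def intro!: hit_measurable\<close>)
    then show ?thesis using 4 by (intro adjacent) auto
  qed
qed

lemma hits_measurable [measurable]: "hits B n d \<in> borel_measurable sample"
  unfolding hits_def by (intro borel_measurable_sum hit_measurable)

lemma hits_bounds: "0 \<le> hits B n d x" "hits B n d x \<le> real (n * d)"
proof -
  show "0 \<le> hits B n d x" unfolding hits_def by (intro sum_nonneg) auto
  have "hits B n d x \<le> (\<Sum>e\<in>band n d. 1)" unfolding hits_def by (intro sum_mono) (auto split: split_indicator)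
  then show "hits B n d x \<le> real (n * d)" by simp
qed

lemma nn_integral_hits: "(\<integral>\<^sup>+x. ennreal (hits B n d x) \<partial>sample) = ennreal (real (n * d) * p)"
proof -
  have "(\<integral>\<^sup>+x. ennreal (hits B n d x) \<partial>sample) = (\<integral>\<^sup>+x. (\<Sum>e\<in>band n d. hit e x) \<partial>sample)"
    by (simp only: ennreal_hits)
  also have "\<dots> = (\<Sum>e\<in>band n d. \<integral>\<^sup>+x. hit e x \<partial>sample)"
    by (intro nn_integral_sum hit_measurable)
  also have "\<dots> = ennreal (real (n * d) * p)"
    using p by (simp add: nn_integral_hit ennreal_mult ennreal_of_nat_eq_real_of_nat)
  finally show ?thesis .
qed

text \<open>Summed over all pairs, the p^2 terms make up the square of the mean. Each of the n d
  pairs adds p for itself and at most 4 d u p for its neighbours, so the variance is at most the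
  mean times 1 + 4 d u.\<close>

lemma nn_integral_hits_squared:
  "(\<integral>\<^sup>+x. ennreal ((hits B n d x)\<^sup>2) \<partial>sample)
    \<le> ennreal ((real (n * d) * p)\<^sup>2 + real (n * d) * p * (1 + 4 * real d * u))"
proof -
  let ?adj = "\<lambda>e e'. {fst e', snd e'} \<inter> {fst e, snd e} \<noteq> {}"
  have nonneg: "0 \<le> p\<^sup>2 + of_bool (?adj e e') * (u * p) + of_bool (e' = e) * p" for e e'
    using u p by (intro add_nonneg_nonneg mult_nonneg_nonneg) auto
  have "(\<integral>\<^sup>+x. ennreal ((hits B n d x)\<^sup>2) \<partial>sample)
      = (\<integral>\<^sup>+x. (\<Sum>e\<in>band n d. \<Sum>e'\<in>band n d. hit e x * hit e' x) \<partial>sample)"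
    using hits_bounds(1)
    by (simp only: power2_eq_square ennreal_mult ennreal_hits sum_product)
  also have "\<dots> = (\<Sum>e\<in>band n d. \<Sum>e'\<in>band n d. \<integral>\<^sup>+x. hit e x * hit e' x \<partial>sample)"
  proof -
    have "(\<integral>\<^sup>+x. (\<Sum>e'\<in>band n d. hit e x * hit e' x) \<partial>sample)
        = (\<Sum>e'\<in>band n d. \<integral>\<^sup>+x. hit e x * hit e' x \<partial>sample)" if "e \<in> band n d" for e
      by (intro nn_integral_sum borel_measurable_times_ennreal hit_measurable that)
    moreover have "(\<integral>\<^sup>+x. (\<Sum>e\<in>band n d. \<Sum>e'\<in>band n d. hit e x * hit e' x) \<partial>sample)
        = (\<Sum>e\<in>band n d. \<integral>\<^sup>+x. (\<Sum>e'\<in>band n d. hit e x * hit e' x) \<partial>sample)"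
      by (intro nn_integral_sum borel_measurable_sum borel_measurable_times_ennreal hit_measurable)
    ultimately show ?thesis by (simp only: cong: sum.cong)
  qed
  also have "\<dots> \<le> (\<Sum>e\<in>band n d. \<Sum>e'\<in>band n d.
      ennreal (p\<^sup>2 + of_bool (?adj e e') * (u * p) + of_bool (e' = e) * p))"
    by (intro sum_mono nn_integral_hit_hit)
  also have "\<dots> = ennreal (\<Sum>e\<in>band n d. \<Sum>e'\<in>band n d.
      p\<^sup>2 + of_bool (?adj e e') * (u * p) + of_bool (e' = e) * p)"
    by (simp only: sum_ennreal[OF nonneg] sum_ennreal[OF sum_nonneg[OF nonneg]])
  also have "\<dots> \<le> ennreal (\<Sum>e\<in>band n d. real (n * d) * p\<^sup>2 + real (4 * d) * (u * p) + p)"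
  proof (intro ennreal_leI sum_mono)
    fix e assume e: "e \<in> band n d"
    have "(\<Sum>e'\<in>band n d. of_bool (?adj e e')) = real (card {e' \<in> band n d. ?adj e e'})"
      by (simp add: of_bool_def sum.If_cases Int_def)
    also have "\<dots> \<le> real (4 * d)"
      by (intro of_nat_mono card_band_adjacent)
    finally have "(\<Sum>e'\<in>band n d. of_bool (?adj e e')) * (u * p) \<le> real (4 * d) * (u * p)"
      using u p by (intro mult_right_mono) auto
    then have "(\<Sum>e'\<in>band n d. of_bool (?adj e e') * (u * p)) \<le> real (4 * d) * (u * p)"
      by (simp only: sum_distrib_right)
    moreover have "(\<Sum>e'\<in>band n d. p\<^sup>2) = real (n * d) * p\<^sup>2" by simp
    moreover have "(\<Sum>e'\<in>band n d. of_bool (e' = e) * p) = p"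
      using e by (simp add: of_bool_def sum.If_cases if_distrib[of "\<lambda>x. x * p"] cong: if_cong)
    ultimately show "(\<Sum>e'\<in>band n d. p\<^sup>2 + of_bool (?adj e e') * (u * p) + of_bool (e' = e) * p)
        \<le> real (n * d) * p\<^sup>2 + real (4 * d) * (u * p) + p"
      unfolding sum.distrib by linarith
  qed
  also have "(\<Sum>e\<in>band n d. real (n * d) * p\<^sup>2 + real (4 * d) * (u * p) + p)
      = (real (n * d) * p)\<^sup>2 + real (n * d) * p * (1 + 4 * real d * u)"
    by (simp add: power2_eq_square algebra_simps)
  finally show ?thesis .
qed

lemma hits_deviation:
  assumes a: "0 < a"
  shows "measure sample {x \<in> space sample. a \<le> \<bar>hits B n d x - real (n * d) * p\<bar>}
    \<le> real (n * d) * p * (1 + 4 * real d * u) / a\<^sup>2"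
proof -
  interpret S: prob_space sample by (rule prob_space_sample)
  have int1: "integrable sample (hits B n d)"
    using hits_bounds by (intro S.integrable_const_bound[of _ "real (n * d)"]) auto
  have int2: "integrable sample (\<lambda>x. (hits B n d x)\<^sup>2)"
    using hits_bounds by (intro S.integrable_const_bound[of _ "(real (n * d))\<^sup>2"]) (auto intro!: power_mono)
  have E1: "S.expectation (hits B n d) = real (n * d) * p"
    using hits_bounds p by (subst integral_eq_nn_integral) (auto simp: nn_integral_hits)
  have E2: "S.expectation (\<lambda>x. (hits B n d x)\<^sup>2) \<le> (real (n * d) * p)\<^sup>2 + real (n * d) * p * (1 + 4 * real d * u)"
    using nn_integral_hits_squared p u
    by (subst integral_eq_nn_integral) (auto intro!: enn2real_leI add_nonneg_nonneg)
  have "S.variance (hits B n d) \<le> real (n * d) * p * (1 + 4 * real d * u)"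
    using S.variance_eq[OF int1 int2] E1 E2 by simp
  moreover have "S.prob {x \<in> space sample. a \<le> \<bar>hits B n d x - S.expectation (hits B n d)\<bar>} \<le> S.variance (hits B n d) / a\<^sup>2"
    by (rule S.Chebyshev_inequality[OF _ int2 a]) measurable
  moreover from calculation have "S.variance (hits B n d) / a\<^sup>2 \<le> real (n * d) * p * (1 + 4 * real d * u) / a\<^sup>2"
    by (intro divide_right_mono) simp_all
  ultimately have "S.prob {x \<in> space sample. a \<le> \<bar>hits B n d x - S.expectation (hits B n d)\<bar>}
      \<le> real (n * d) * p * (1 + 4 * real d * u) / a\<^sup>2"
    by linarith
  then show ?thesis unfolding E1 .
qed

end

section \<open>The tester\<close>

text \<open>Non-adaptive querying: the list is fixed in advance, and the answers are written into a
  valuation on top of \<open>undefined\<close>. Hence P has to depend on the listed positions only,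
  as \<open>verdict_ask\<close> demands.\<close>

primrec ask :: "nat list \<Rightarrow> ((nat \<Rightarrow> 'y) \<Rightarrow> bool) \<Rightarrow> 'y query_tree" where
  "ask [] P = Decide (P undefined)"
| "ask (i # is) P = Query i (\<lambda>y. ask is (\<lambda>v. P (v(i := y))))"

lemma queried_ask: "queried (ask is P) v = set is"
  by (induction "is" arbitrary: P) auto

lemma verdict_ask:
  assumes "\<And>v w. (\<And>i. i \<in> set is \<Longrightarrow> v i = w i) \<Longrightarrow> P v = P w"
  shows "verdict (ask is P) v = P v"
  using assms
proof (induction "is" arbitrary: P)
  case Nil
  then show ?case by simp
next
  case (Cons i "is")
  have "verdict (ask is (\<lambda>w. P (w(i := v i)))) v = P (v(i := v i))"
    by (rule Cons.IH) (auto intro!: Cons.prems)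
  then show ?case by simp
qed

definition close_pairs :: "nat \<Rightarrow> nat \<Rightarrow> real \<Rightarrow> (nat \<Rightarrow> real) \<Rightarrow> (nat \<times> nat) set" where
  "close_pairs n d u x = {e \<in> band n d. x (fst e) \<le> x (snd e) \<and> x (snd e) \<le> x (fst e) + u}"

text \<open>The positions to query are chosen from the sample locations alone. If there are too many
  close pairs, the tester accepts without a query: the query bound then holds on every run, and the
  overflow can spoil only rejections.\<close>

definition band_tester :: "nat \<Rightarrow> nat \<Rightarrow> nat \<Rightarrow> real \<Rightarrow> real \<Rightarrow> 'y algorithm" where
  "band_tester n d q u \<theta> = \<lparr>coins = unif01, sample_size = n + d,
     strategy = \<lambda>r x. let E = close_pairs n d u x in
       if 2 * card E \<le> q
       then ask (sorted_list_of_set (fst ` E \<union> snd ` E)) (\<lambda>v. real (card {e \<in> E. v (fst e) \<noteq> v (snd e)}) \<le> \<theta>)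
       else Decide True\<rparr>"

definition close_set :: "real \<Rightarrow> (real \<times> real) set" where
  "close_set u = {(a, b). a \<le> b \<and> b \<le> a + u}"

definition split_set :: "(real \<Rightarrow> 'y) \<Rightarrow> real \<Rightarrow> (real \<times> real) set" where
  "split_set f u = {(a, b). a \<le> b \<and> b \<le> a + u \<and> f a \<noteq> f b}"

lemma finite_close_pairs [simp]: "finite (close_pairs n d u x)"
  by (simp add: close_pairs_def)

lemma card_close_pairs: "real (card (close_pairs n d u x)) = hits (close_set u) n d x"
  by (simp add: hits_def close_pairs_def close_set_def indicator_def sum.If_cases Int_def)

lemma card_split_pairs:
  "real (card {e \<in> close_pairs n d u x. f (x (fst e)) \<noteq> f (x (snd e))}) = hits (split_set f u) n d x"
  by (simp add: hits_def close_pairs_def split_set_def indicator_def sum.If_cases Int_def conj_assoc)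

lemma verdict_band_tester:
  "verdict (strategy (band_tester n d q u \<theta>) r x) (\<lambda>i. f (x i)) \<longleftrightarrow>
     \<not> 2 * hits (close_set u) n d x \<le> real q \<or> hits (split_set f u) n d x \<le> \<theta>"
proof -
  let ?E = "close_pairs n d u x"
  have "verdict (ask (sorted_list_of_set (fst ` ?E \<union> snd ` ?E))
      (\<lambda>v. real (card {e \<in> ?E. v (fst e) \<noteq> v (snd e)}) \<le> \<theta>)) (\<lambda>i. f (x i))
    \<longleftrightarrow> real (card {e \<in> ?E. f (x (fst e)) \<noteq> f (x (snd e))}) \<le> \<theta>"
  proof (rule verdict_ask)
    fix v w :: "nat \<Rightarrow> 'a"
    assume "\<And>i. i \<in> set (sorted_list_of_set (fst ` ?E \<union> snd ` ?E)) \<Longrightarrow> v i = w i"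
    then have "v (fst e) = w (fst e) \<and> v (snd e) = w (snd e)" if "e \<in> ?E" for e
      using that by simp
    then have "{e \<in> ?E. v (fst e) \<noteq> v (snd e)} = {e \<in> ?E. w (fst e) \<noteq> w (snd e)}"
      by (intro Collect_cong) auto
    then show "(real (card {e \<in> ?E. v (fst e) \<noteq> v (snd e)}) \<le> \<theta>)
        = (real (card {e \<in> ?E. w (fst e) \<noteq> w (snd e)}) \<le> \<theta>)" by simp
  qed
  moreover have "2 * hits (close_set u) n d x \<le> real q \<longleftrightarrow> 2 * card ?E \<le> q"
    unfolding card_close_pairs[symmetric] by linarith
  ultimately show ?thesis
    by (simp add: band_tester_def Let_def card_split_pairs)
qed

lemma queried_band_tester:
  "queried (strategy (band_tester n d q u \<theta>) r x) v \<subseteq> {..<n + d}"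
  "card (queried (strategy (band_tester n d q u \<theta>) r x) v) \<le> min q (n + d)"
proof -
  let ?E = "close_pairs n d u x"
  let ?Q = "queried (strategy (band_tester n d q u \<theta>) r x) v"
  show sub: "?Q \<subseteq> {..<n + d}"
    by (auto simp: band_tester_def Let_def queried_ask close_pairs_def band_def)
  have "card ?Q \<le> q"
  proof (cases "2 * card ?E \<le> q")
    case True
    have "card ?Q = card (fst ` ?E \<union> snd ` ?E)"
      using True by (simp add: band_tester_def Let_def queried_ask)
    also have "\<dots> \<le> card (fst ` ?E) + card (snd ` ?E)" by (rule card_Un_le)
    also have "\<dots> \<le> 2 * card ?E"
      using card_image_le[of ?E fst] card_image_le[of ?E snd] by simp
    finally show ?thesis using True by simp
  qed (simp add: band_tester_def Let_def)
  moreover have "card ?Q \<le> n + d"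
    using card_mono[OF _ sub] by simp
  ultimately show "card ?Q \<le> min q (n + d)" by simp
qed

lemma close_set_measurable [measurable]: "close_set u \<in> sets (borel \<Otimes>\<^sub>M borel)"
proof -
  have "{p \<in> space (borel \<Otimes>\<^sub>M borel). fst p \<le> snd p \<and> snd p \<le> fst p + u} \<in> sets (borel \<Otimes>\<^sub>M borel)"
    by measurable
  then show ?thesis by (simp add: close_set_def space_pair_measure case_prod_beta')
qed

lemma split_set_measurable:
  assumes "{p :: real \<times> real. f (fst p) \<noteq> f (snd p)} \<in> sets (borel \<Otimes>\<^sub>M borel)"
  shows "split_set f u \<in> sets (borel \<Otimes>\<^sub>M borel)"
proof -
  have "split_set f u = close_set u \<inter> {p. f (fst p) \<noteq> f (snd p)}"
    by (auto simp: split_set_def close_set_def)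
  then show ?thesis using assms by auto
qed

lemma close_set_section_le:
  assumes "0 \<le> u"
  shows "(\<integral>\<^sup>+a. indicator (close_set u) (a, b) \<partial>unif01) \<le> ennreal u"
    and "(\<integral>\<^sup>+b. indicator (close_set u) (a, b) \<partial>unif01) \<le> ennreal u"
proof -
  have le: "(\<integral>\<^sup>+a. indicator {c..c + u} a \<partial>unif01) \<le> ennreal u" for c
  proof -
    have "(\<integral>\<^sup>+a. indicator {c..c + u} a \<partial>unif01) = emeasure lborel ({0<..<1} \<inter> {c..c + u})"
      by (simp add: emeasure_unif01)
    also have "\<dots> \<le> emeasure lborel {c..c + u}" by (rule emeasure_mono) auto
    finally show ?thesis using assms by simp
  qed
  have 1: "indicator (close_set u) (a, b) = (indicator {b - u..b - u + u} a :: ennreal)"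
    and 2: "indicator (close_set u) (a, b) = (indicator {a..a + u} b :: ennreal)" for a b
    by (auto simp: close_set_def split: split_indicator)
  show "(\<integral>\<^sup>+a. indicator (close_set u) (a, b) \<partial>unif01) \<le> ennreal u"
    unfolding 1 by (rule le)
  show "(\<integral>\<^sup>+b. indicator (close_set u) (a, b) \<partial>unif01) \<le> ennreal u"
    unfolding 2 by (rule le)
qed

lemma split_set_section_le:
  assumes "0 \<le> u"
  shows "(\<integral>\<^sup>+a. indicator (split_set f u) (a, b) \<partial>unif01) \<le> ennreal u"
    and "(\<integral>\<^sup>+b. indicator (split_set f u) (a, b) \<partial>unif01) \<le> ennreal u"
proof -
  have "indicator (split_set f u) p \<le> (indicator (close_set u) p :: ennreal)" for p
    by (auto simp: close_set_def split_set_def split: split_indicator)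
  note le = nn_integral_mono[OF this]
  show "(\<integral>\<^sup>+a. indicator (split_set f u) (a, b) \<partial>unif01) \<le> ennreal u"
    by (rule order.trans[OF le close_set_section_le(1)[OF assms]])
  show "(\<integral>\<^sup>+b. indicator (split_set f u) (a, b) \<partial>unif01) \<le> ennreal u"
    by (rule order.trans[OF le close_set_section_le(2)[OF assms]])
qed

text \<open>Substituting b = a + w and exchanging the integrals turns the probability that two
  random points form a split pair into the integral of the noise; membership of both points in (0,1)
  is the guard inside \<open>jump\<close>.\<close>

lemma split_set_mass:
  assumes pairs: "{p :: real \<times> real. f (fst p) \<noteq> f (snd p)} \<in> sets (borel \<Otimes>\<^sub>M borel)"
  shows "(\<integral>\<^sup>+b. \<integral>\<^sup>+a. indicator (split_set f u) (a, b) \<partial>unif01 \<partial>unif01)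
    = (\<integral>\<^sup>+w\<in>{0..u}. noise f w \<partial>lborel)"
proof -
  note [measurable] = split_set_measurable[OF pairs, of u]
  note [measurable (raw)] = jump_measurable_compose[OF pairs]
  let ?B = "split_set f u" and ?U = "{0<..<1} :: real set"
  have "(\<integral>\<^sup>+b. \<integral>\<^sup>+a. indicator ?B (a, b) \<partial>unif01 \<partial>unif01)
      = (\<integral>\<^sup>+b. (\<integral>\<^sup>+a. indicator ?B (a, b) * indicator ?U a \<partial>lborel) * indicator ?U b \<partial>lborel)"
    by (simp add: nn_integral_unif01)
  also have "\<dots> = (\<integral>\<^sup>+b. \<integral>\<^sup>+a. indicator ?B (a, b) * indicator ?U a * indicator ?U b \<partial>lborel \<partial>lborel)"
    by (simp add: nn_integral_multc)
  also have "\<dots> = (\<integral>\<^sup>+a. \<integral>\<^sup>+b. indicator ?B (a, b) * indicator ?U a * indicator ?U b \<partial>lborel \<partial>lborel)"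
    by (rule lborel_pair.Fubini') measurable
  also have "\<dots> = (\<integral>\<^sup>+a. \<integral>\<^sup>+w. jump f a w * indicator {0..u} w \<partial>lborel \<partial>lborel)"
  proof (rule nn_integral_cong)
    fix a :: real
    have "(\<integral>\<^sup>+b. indicator ?B (a, b) * indicator ?U a * indicator ?U b \<partial>lborel)
        = (\<integral>\<^sup>+w. indicator ?B (a, a + 1 * w) * indicator ?U a * indicator ?U (a + 1 * w) \<partial>lborel)"
      by (subst nn_integral_real_affine[of _ 1 a]) auto
    also have "\<dots> = (\<integral>\<^sup>+w. jump f a w * indicator {0..u} w \<partial>lborel)"
      by (intro nn_integral_cong) (auto simp: split_set_def jump_def split: split_indicator)
    finally show "(\<integral>\<^sup>+b. indicator ?B (a, b) * indicator ?U a * indicator ?U b \<partial>lborel)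
        = (\<integral>\<^sup>+w. jump f a w * indicator {0..u} w \<partial>lborel)" .
  qed
  also have "\<dots> = (\<integral>\<^sup>+w. \<integral>\<^sup>+a. jump f a w * indicator {0..u} w \<partial>lborel \<partial>lborel)"
    by (rule lborel_pair.Fubini'[symmetric]) measurable
  also have "\<dots> = (\<integral>\<^sup>+w\<in>{0..u}. noise f w \<partial>lborel)"
    unfolding noise_def by (simp add: nn_integral_multc)
  finally show ?thesis .
qed

section \<open>Error probabilities of the tester\<close>

lemma measure_run_space:
  assumes "prob_space (coins A)" and S: "S \<in> sets (\<Pi>\<^sub>M i\<in>{..<sample_size A}. unif01)"
  shows "space (coins A) \<times> S \<in> sets (run_space A)"
    and "measure (run_space A) (space (coins A) \<times> S) = measure (\<Pi>\<^sub>M i\<in>{..<sample_size A}. unif01) S"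
proof -
  interpret P: prob_space "\<Pi>\<^sub>M i\<in>{..<sample_size A}. unif01"
    by (rule prob_space_PiM[OF prob_space_unif01])
  show "space (coins A) \<times> S \<in> sets (run_space A)"
    unfolding run_space_def using S by auto
  show "measure (run_space A) (space (coins A) \<times> S) = measure (\<Pi>\<^sub>M i\<in>{..<sample_size A}. unif01) S"
    unfolding run_space_def measure_def using S
    by (subst P.emeasure_pair_measure_Times) (auto simp: prob_space.emeasure_space_1[OF assms(1)])
qed

text \<open>The condition 4 d u \<le> 1 bounds the variance by twice the mean, so Chebyshev with 12
  times the mean at most c^2 leaves 1/6.\<close>

lemma split_pairs_deviation:
  fixes n d :: nat and u p :: real
  assumes pairs: "{p :: real \<times> real. f (fst p) \<noteq> f (snd p)} \<in> sets (borel \<Otimes>\<^sub>M borel)"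
    and u: "0 \<le> u" "4 * real d * u \<le> 1"
    and p: "(\<integral>\<^sup>+w\<in>{0..u}. noise f w \<partial>lborel) = ennreal p" "0 \<le> p"
    and c: "0 < c" "12 * (real (n * d) * p) \<le> c\<^sup>2"
  shows "measure (\<Pi>\<^sub>M i\<in>{..<n + d}. unif01)
      {x \<in> space (\<Pi>\<^sub>M i\<in>{..<n + d}. unif01). c \<le> \<bar>hits (split_set f u) n d x - real (n * d) * p\<bar>} \<le> 1 / 6"
proof -
  have S: "split_set f u \<in> sets (unif01 \<Otimes>\<^sub>M unif01)"
    using split_set_measurable[OF pairs, of u] by (simp cong: sets_pair_measure_cong)
  have "measure (\<Pi>\<^sub>M i\<in>{..<n + d}. unif01)
      {x \<in> space (\<Pi>\<^sub>M i\<in>{..<n + d}. unif01). c \<le> \<bar>hits (split_set f u) n d x - real (n * d) * p\<bar>}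
    \<le> real (n * d) * p * (1 + 4 * real d * u) / c\<^sup>2"
    by (rule hits_deviation[OF prob_space_unif01 S _ p(2) _ _ u(1) c(1)])
       (auto simp: split_set_mass[OF pairs] p intro: split_set_section_le[OF u(1)])
  also have "\<dots> \<le> real (n * d) * p * 2 / c\<^sup>2"
    using u p by (intro divide_right_mono mult_left_mono) auto
  also have "\<dots> \<le> 1 / 6" using c by (simp add: field_simps)
  finally show ?thesis .
qed

text \<open>Markov's inequality: the expected number of close pairs is at most n d u, since a second
  point falls next to a given one with probability at most u.\<close>

lemma close_pairs_overflow:
  fixes n d q :: nat and u :: real
  assumes u: "0 \<le> u" and q: "12 * (real (n * d) * u) \<le> real q + 1"
  shows "measure (\<Pi>\<^sub>M i\<in>{..<n + d}. unif01)
      {x \<in> space (\<Pi>\<^sub>M i\<in>{..<n + d}. unif01). \<not> 2 * hits (close_set u) n d x \<le> real q} \<le> 1 / 6"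
proof -
  let ?P = "\<Pi>\<^sub>M i\<in>{..<n + d}. unif01"
  let ?S = "{x \<in> space ?P. \<not> 2 * hits (close_set u) n d x \<le> real q}"
  interpret P: prob_space ?P by (rule prob_space_PiM[OF prob_space_unif01])
  have S: "close_set u \<in> sets (unif01 \<Otimes>\<^sub>M unif01)"
    using close_set_measurable[of u] by (simp cong: sets_pair_measure_cong)
  define p where "p = enn2real (\<integral>\<^sup>+b. \<integral>\<^sup>+a. indicator (close_set u) (a, b) \<partial>unif01 \<partial>unif01)"
  have "(\<integral>\<^sup>+b. \<integral>\<^sup>+a. indicator (close_set u) (a, b) \<partial>unif01 \<partial>unif01) \<le> (\<integral>\<^sup>+b. ennreal u \<partial>unif01)"
    by (intro nn_integral_mono close_set_section_le u)
  also have "\<dots> = ennreal u" by (simp add: unif01.emeasure_space_1[simplified])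
  finally have le: "(\<integral>\<^sup>+b. \<integral>\<^sup>+a. indicator (close_set u) (a, b) \<partial>unif01 \<partial>unif01) \<le> ennreal u" .
  then have p: "(\<integral>\<^sup>+b. \<integral>\<^sup>+a. indicator (close_set u) (a, b) \<partial>unif01 \<partial>unif01) = ennreal p"
    unfolding p_def by (subst ennreal_enn2real) (auto intro: le_less_trans)
  have p0: "0 \<le> p" by (simp add: p_def)
  have pu: "p \<le> u" using le u unfolding p by (simp add: p0)
  note sec = close_set_section_le[OF u]
  note meas = hits_measurable[OF prob_space_unif01 S p p0 sec u, of n d]
  have m: "?S \<in> sets ?P" using meas by measurable
  have "ennreal (real q + 1) * emeasure ?P ?S = (\<integral>\<^sup>+x. ennreal (real q + 1) * indicator ?S x \<partial>?P)"
    using m by (simp add: nn_integral_cmult_indicator)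
  also have "\<dots> \<le> (\<integral>\<^sup>+x. 2 * ennreal (hits (close_set u) n d x) \<partial>?P)"
  proof (rule nn_integral_mono)
    fix x
    \<comment> \<open>Hit counts are integers, so exceeding q means reaching q + 1; this keeps the
      estimate meaningful even for q = 0.\<close>
    have "real q + 1 \<le> 2 * hits (close_set u) n d x" if "\<not> 2 * hits (close_set u) n d x \<le> real q"
    proof -
      have "q < 2 * card (close_pairs n d u x)"
        using that unfolding card_close_pairs[symmetric] by linarith
      then have "real (q + 1) \<le> real (2 * card (close_pairs n d u x))"
        by (intro of_nat_mono) simp
      then show ?thesis unfolding card_close_pairs[symmetric] by simp
    qed
    moreover have "2 * ennreal (hits (close_set u) n d x) = ennreal (2 * hits (close_set u) n d x)"
      by (simp add: ennreal_mult hits_def sum_nonneg)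
    ultimately show "ennreal (real q + 1) * indicator ?S x \<le> 2 * ennreal (hits (close_set u) n d x)"
      by (cases "x \<in> ?S") (auto simp del: ennreal_plus intro!: ennreal_leI)
  qed
  also have "\<dots> = 2 * ennreal (real (n * d) * p)"
    using nn_integral_hits[OF prob_space_unif01 S p p0 sec u, of n d] meas
    by (subst nn_integral_cmult) auto
  also have "\<dots> = ennreal (2 * (real (n * d) * p))"
    using p0 by (simp flip: ennreal_numeral add: ennreal_mult)
  finally have "ennreal ((real q + 1) * P.prob ?S) \<le> ennreal (2 * (real (n * d) * p))"
    by (simp add: P.emeasure_eq_measure ennreal_mult)
  then have "(real q + 1) * P.prob ?S \<le> 2 * (real (n * d) * p)"
    using p0 by (subst (asm) ennreal_le_iff) auto
  also have "\<dots> \<le> 2 * (real (n * d) * u)" using pu by (intro mult_left_mono) auto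
  also have "\<dots> \<le> (real q + 1) / 6" using q by simp
  finally have "(real q + 1) * P.prob ?S \<le> (real q + 1) * (1 / 6)" by simp
  then show ?thesis by (rule mult_left_le_imp_le) simp
qed

text \<open>The threshold \<theta> lies midway between the largest mean a (k - 1) possible on the
  class and the smallest mean a (k - 1 + k \<epsilon>/4) possible at distance \<epsilon>; g is half
  the gap. A class member is rejected only after a deviation (1/6), a far function is accepted only
  after a deviation or an overflow (1/6 + 1/6).\<close>

lemma band_tester_correct:
  fixes n d q k :: nat and \<epsilon> u :: real
  assumes Y: "disagreement_measurable Y" and k: "k \<ge> 1" and \<epsilon>: "0 < \<epsilon>" "\<epsilon> < 1 / 2"
    and u: "u = \<epsilon>\<^sup>2 / (64 * real k)" and d: "4 * real d * u \<le> 1"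
    and m: "10 ^ 7 * real k \<le> real (n * d) * \<epsilon> ^ 6"
    and q: "12 * (real (n * d) * u) \<le> real q + 1"
    and \<theta>: "\<theta> = real (n * d) * u\<^sup>2 / 2 * (real k - 1 + real k * \<epsilon> / 8)"
  shows "is_tester Y (piecewise_class k (constant_functions Y)) (n + d) (min q (n + d)) \<epsilon>
    (band_tester n d q u \<theta>)"
proof -
  let ?A = "band_tester n d q u \<theta> :: 'a algorithm"
  let ?F = "piecewise_class k (constant_functions Y)"
  let ?P = "\<Pi>\<^sub>M i\<in>{..<n + d}. unif01"
  interpret P: prob_space ?P by (rule prob_space_PiM[OF prob_space_unif01])
  have A: "coins ?A = unif01" "sample_size ?A = n + d" by (simp_all add: band_tester_def)
  have upos: "0 < u" using u k \<epsilon> by simp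
  define a where "a = real (n * d) * u\<^sup>2 / 2"
  define g where "g = a * real k * \<epsilon> / 8"
  have a: "0 \<le> a" by (simp add: a_def)
  \<comment> \<open>Since g^2 = (a k)(a k \<epsilon>^2)/64, the constant 864 yields g^2 \<ge> 27/2 a
    k with 27/2 = 12 * 9/8, which suits means up to 9/8 a k. The constant 10^7 covers 864 *
    8192.\<close>
  have big: "864 \<le> a * real k * \<epsilon>\<^sup>2"
  proof -
    have "a * real k * \<epsilon>\<^sup>2 = real (n * d) * \<epsilon> ^ 6 / (8192 * real k)"
      using k unfolding a_def u by (simp add: field_simps power_divide) (simp add: eval_nat_numeral)
    moreover have "864 * (8192 * real k) \<le> real (n * d) * \<epsilon> ^ 6" using m by simp
    ultimately show ?thesis using k by (simp add: pos_le_divide_eq)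
  qed
  have ak: "0 < a * real k"
    using big a by (metis less_eq_real_def mult_nonneg_nonneg mult_zero_left not_numeral_le_zero of_nat_0_le_iff)
  have g: "0 < g" "6 \<le> g" "27 / 2 * (a * real k) \<le> g\<^sup>2"
  proof -
    show "0 < g" using ak \<epsilon> by (simp add: g_def)
    have "a * real k * \<epsilon>\<^sup>2 \<le> a * real k * \<epsilon>"
      using ak \<epsilon> by (intro mult_left_mono) (auto simp: power2_eq_square mult_left_le)
    then show "6 \<le> g" using big by (simp add: g_def)
    have "27 / 2 * (a * real k) = (a * real k) * (864 / 64)" by simp
    also have "\<dots> \<le> (a * real k) * (a * real k * \<epsilon>\<^sup>2 / 64)"
      using big ak by (intro mult_left_mono) auto
    finally show "27 / 2 * (a * real k) \<le> g\<^sup>2" by (simp add: g_def power2_eq_square mult_ac)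
  qed
  have body: "accept_event ?A f \<in> sets (run_space ?A) \<and>
      (f \<in> ?F \<longrightarrow> measure (run_space ?A) (accept_event ?A f) \<ge> 2 / 3) \<and>
      (class_dist f ?F \<ge> \<epsilon> \<longrightarrow> measure (run_space ?A) (reject_event ?A f) \<ge> 2 / 3)"
    if f: "f \<in> borel \<rightarrow>\<^sub>M Y" for f
  proof -
    note pairs = disagreement_pairs_measurable[OF Y f]
    define p where "p = enn2real (\<integral>\<^sup>+w\<in>{0..u}. noise f w \<partial>lborel)"
    have S: "split_set f u \<in> sets (unif01 \<Otimes>\<^sub>M unif01)" "close_set u \<in> sets (unif01 \<Otimes>\<^sub>M unif01)"
      using split_set_measurable[OF pairs, of u] close_set_measurable[of u]
      by (simp_all cong: sets_pair_measure_cong)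
    have "(\<integral>\<^sup>+w\<in>{0..u}. noise f w \<partial>lborel) \<le> (\<integral>\<^sup>+b. ennreal u \<partial>unif01)"
      unfolding split_set_mass[OF pairs, symmetric]
      using upos by (intro nn_integral_mono split_set_section_le) auto
    also have "\<dots> < \<infinity>" by (simp add: unif01.emeasure_space_1[simplified])
    finally have p: "(\<integral>\<^sup>+w\<in>{0..u}. noise f w \<partial>lborel) = ennreal p"
      unfolding p_def by simp
    have p0: "0 \<le> p" by (simp add: p_def)
    define \<mu> where "\<mu> = real (n * d) * p"
    define Z where "Z = hits (split_set f u) n d"
    define T where "T = hits (close_set u) n d"
    have Zm [measurable]: "Z \<in> borel_measurable ?P"
      unfolding Z_def hits_def using S(1)
      by (intro borel_measurable_sum measurable_PiM_pair[OF prob_space_unif01]) (auto simp: band_def)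
    have Tm [measurable]: "T \<in> borel_measurable ?P"
      unfolding T_def hits_def using S(2)
      by (intro borel_measurable_sum measurable_PiM_pair[OF prob_space_unif01]) (auto simp: band_def)
    have dev: "P.prob {x \<in> space ?P. c \<le> \<bar>Z x - \<mu>\<bar>} \<le> 1 / 6" if "0 < c" "12 * \<mu> \<le> c\<^sup>2" for c
      using split_pairs_deviation[OF pairs _ d p p0 that(1)] that(2) upos unfolding \<mu>_def Z_def by simp
    have over: "P.prob {x \<in> space ?P. \<not> 2 * T x \<le> real q} \<le> 1 / 6"
      unfolding T_def using close_pairs_overflow[OF _ q] upos by simp
    let ?acc = "{x \<in> space ?P. \<not> 2 * T x \<le> real q \<or> Z x \<le> \<theta>}"
    let ?rej = "{x \<in> space ?P. \<not> (\<not> 2 * T x \<le> real q \<or> Z x \<le> \<theta>)}"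
    have acc: "accept_event ?A f = space (coins ?A) \<times> ?acc"
      unfolding accept_event_def verdict_band_tester Z_def T_def
      by (auto simp: run_space_def A space_pair_measure)
    have rej: "reject_event ?A f = space (coins ?A) \<times> ?rej"
      unfolding reject_event_def verdict_band_tester Z_def T_def
      by (auto simp: run_space_def A space_pair_measure)
    have coins: "prob_space (coins ?A)" by (simp add: A prob_space_unif01)
    have macc: "?acc \<in> sets (\<Pi>\<^sub>M i\<in>{..<sample_size ?A}. unif01)" unfolding A by measurable
    have mrej: "?rej \<in> sets (\<Pi>\<^sub>M i\<in>{..<sample_size ?A}. unif01)" unfolding A by measurable
    note run_acc = measure_run_space[OF coins macc, unfolded A(2)]
    note run_rej = measure_run_space[OF coins mrej, unfolded A(2)]
    have compl: "P.prob ?acc + P.prob ?rej = 1"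
      using P.prob_neg[of "\<lambda>x. \<not> 2 * T x \<le> real q \<or> Z x \<le> \<theta>"] macc unfolding A by simp
    have "\<theta> = a * (real k - 1 + real k * \<epsilon> / 8)" by (simp add: \<theta> a_def)
    then have \<theta>': "\<theta> = a * (real k - 1) + g" by (simp add: g_def algebra_simps)
    have yes: "2 / 3 \<le> P.prob ?acc" if F: "f \<in> ?F"
    proof -
      have "ennreal p \<le> ennreal (u\<^sup>2 / 2 * (real k - 1))"
        using noise_integral_le_of_piecewise[OF F _ k, of u] upos p by simp
      then have "p \<le> u\<^sup>2 / 2 * (real k - 1)" using k by (subst (asm) ennreal_le_iff) auto
      then have "real (n * d) * p \<le> real (n * d) * (u\<^sup>2 / 2 * (real k - 1))"
        by (intro mult_left_mono) auto
      then have \<mu>: "\<mu> \<le> a * (real k - 1)" by (simp add: \<mu>_def a_def)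
      also have "\<dots> \<le> a * real k" using a by (intro mult_left_mono) auto
      finally have "12 * \<mu> \<le> g\<^sup>2" using g(3) ak by linarith
      \<comment> \<open>Rejection forces Z above \<theta>, hence more than g above the mean; an
        overflow would only help here.\<close>
      have "P.prob ?rej \<le> P.prob {x \<in> space ?P. g \<le> \<bar>Z x - \<mu>\<bar>}"
        using \<mu> by (intro P.finite_measure_mono) (auto simp: \<theta>', measurable)
      also have "\<dots> \<le> 1 / 6" by (rule dev) fact+
      finally show ?thesis using compl by linarith
    qed
    have no: "2 / 3 \<le> P.prob ?rej" if F: "class_dist f ?F \<ge> \<epsilon>"
    proof -
      define \<mu>\<^sub>0 where "\<mu>\<^sub>0 = a * (real k - 1 + real k * \<epsilon> / 4)"
      have \<theta>0: "\<theta> = \<mu>\<^sub>0 - g" by (simp add: \<theta>' \<mu>\<^sub>0_def g_def algebra_simps)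
      have "ennreal (u\<^sup>2 / 2 * (real k - 1 + real k * \<epsilon> / 4)) \<le> ennreal p"
        using noise_integral_ge_of_far[OF Y f k \<epsilon> u F] p by simp
      then have "u\<^sup>2 / 2 * (real k - 1 + real k * \<epsilon> / 4) \<le> p" using p0 by (subst (asm) ennreal_le_iff) auto
      then have "real (n * d) * (u\<^sup>2 / 2 * (real k - 1 + real k * \<epsilon> / 4)) \<le> real (n * d) * p"
        by (intro mult_left_mono) auto
      then have \<mu>: "\<mu>\<^sub>0 \<le> \<mu>" by (simp add: \<mu>_def \<mu>\<^sub>0_def a_def)
      have "real k * \<epsilon> \<le> real k * (1 / 2)" using \<epsilon> by (intro mult_left_mono) auto
      then have "real k - 1 + real k * \<epsilon> / 4 \<le> 9 / 8 * real k" by linarith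
      then have "\<mu>\<^sub>0 \<le> a * (9 / 8 * real k)" unfolding \<mu>\<^sub>0_def using a by (intro mult_left_mono)
      then have "12 * \<mu>\<^sub>0 \<le> g\<^sup>2" using g(3) by simp
      \<comment> \<open>The mean may lie far above \<mu>\<open>\<^sub>0\<close>, and the variance
        grows with it. The mixed term 2 g (\<mu> - \<mu>\<open>\<^sub>0\<close>) of the squared
        distance to \<theta> absorbs this growth because g \<ge> 6.\<close>
      moreover have "12 * (\<mu> - \<mu>\<^sub>0) \<le> 2 * g * (\<mu> - \<mu>\<^sub>0)" using g(2) \<mu> by (intro mult_right_mono) auto
      moreover have "(\<mu> - \<theta>)\<^sup>2 = g\<^sup>2 + 2 * g * (\<mu> - \<mu>\<^sub>0) + (\<mu> - \<mu>\<^sub>0)\<^sup>2"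
        by (simp add: \<theta>0 power2_eq_square algebra_simps)
      moreover have "0 \<le> (\<mu> - \<mu>\<^sub>0)\<^sup>2" by simp
      ultimately have sq: "12 * \<mu> \<le> (\<mu> - \<theta>)\<^sup>2" by argo
      have pos: "0 < \<mu> - \<theta>" using \<mu> g(1) by (simp add: \<theta>0)
      have "P.prob ?acc \<le> P.prob ({x \<in> space ?P. \<not> 2 * T x \<le> real q} \<union> {x \<in> space ?P. \<mu> - \<theta> \<le> \<bar>Z x - \<mu>\<bar>})"
        by (intro P.finite_measure_mono) (auto, measurable)
      also have "\<dots> \<le> P.prob {x \<in> space ?P. \<not> 2 * T x \<le> real q} + P.prob {x \<in> space ?P. \<mu> - \<theta> \<le> \<bar>Z x - \<mu>\<bar>}"
        by (intro measure_Un_le) measurable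
      also have "\<dots> \<le> 1 / 6 + 1 / 6" by (intro add_mono over dev pos sq)
      finally show ?thesis using compl by linarith
    qed
    show ?thesis using run_acc run_rej yes no unfolding acc rej by simp
  qed
  have "\<forall>(r, x)\<in>space (run_space ?A). queried (strategy ?A r x) (\<lambda>i. f (x i)) \<subseteq> {..<n + d} \<and>
      card (queried (strategy ?A r x) (\<lambda>i. f (x i))) \<le> min q (n + d)" for f
    by (intro ballI) (simp only: split_beta, intro conjI queried_band_tester)
  then show ?thesis
    unfolding is_tester_def A using body prob_space_unif01 order.refl[of "n + d"] by blast
qed

text \<open>Up to constants d is \<surd>k/\<epsilon> and n is \<surd>k/\<epsilon>^5. Then n d is of
  order k/\<epsilon>^6 as accuracy requires, d u is of order \<epsilon>/\<surd>k so that
  dependencies remain weak, and n d u, which governs the number of close pairs, is of order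
  1/\<epsilon>^4.\<close>

lemma piecewise_tester_exists:
  assumes Y: "disagreement_measurable Y" and k: "k \<ge> 1" and \<epsilon>: "0 < \<epsilon>" "\<epsilon> < 1 / 2"
  obtains s q and A :: "'y algorithm"
  where "is_tester Y (piecewise_class k (constant_functions Y)) s q \<epsilon> A" "q \<le> s"
    "real s \<le> 2 * 10 ^ 7 * (sqrt (real k) / \<epsilon> ^ 5)" "real q \<le> 2 * 10 ^ 7 * (1 / \<epsilon> ^ 4)"
proof -
  define u where "u = \<epsilon>\<^sup>2 / (64 * real k)"
  define r where "r = sqrt (real k)"
  define d where "d = nat \<lceil>r / \<epsilon>\<rceil>"
  define n where "n = nat \<lceil>10 ^ 7 * (r / \<epsilon> ^ 5)\<rceil>"
  define q where "q = nat \<lfloor>12 * (real (n * d) * u)\<rfloor>"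
  have r: "1 \<le> r" "r * r = real k" using k by (simp_all add: r_def)
  have upos: "0 < u" using \<epsilon> k by (simp add: u_def)
  have e5: "\<epsilon> ^ 5 \<le> \<epsilon>" using \<epsilon> power_decreasing[of 1 5 \<epsilon>] by simp
  have "1 \<le> r / \<epsilon>" using r \<epsilon> by (simp add: field_simps)
  moreover have re: "r / \<epsilon> \<le> r / \<epsilon> ^ 5" using e5 r \<epsilon> by (intro divide_left_mono) auto
  ultimately have re5: "1 \<le> r / \<epsilon> ^ 5" by linarith
  have d: "r / \<epsilon> \<le> real d" "real d \<le> 2 * (r / \<epsilon>)"
    unfolding d_def using \<open>1 \<le> r / \<epsilon>\<close> by linarith+
  have n: "10 ^ 7 * (r / \<epsilon> ^ 5) \<le> real n" "real n \<le> (10 ^ 7 + 1) * (r / \<epsilon> ^ 5)"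
  proof -
    have "0 \<le> 10 ^ 7 * (r / \<epsilon> ^ 5)" using re5 by simp
    then have "real n \<le> 10 ^ 7 * (r / \<epsilon> ^ 5) + 1" "10 ^ 7 * (r / \<epsilon> ^ 5) \<le> real n"
      unfolding n_def by linarith+
    then show "10 ^ 7 * (r / \<epsilon> ^ 5) \<le> real n" "real n \<le> (10 ^ 7 + 1) * (r / \<epsilon> ^ 5)"
      using re5 unfolding distrib_right by linarith+
  qed
  have "4 * real d * u \<le> 4 * (2 * (r / \<epsilon>)) * u" using d upos by (intro mult_right_mono mult_left_mono) auto
  also have "\<dots> = \<epsilon> / (8 * r)"
    using r \<epsilon> unfolding u_def r(2)[symmetric] by (simp add: field_simps power2_eq_square)
  also have "\<dots> \<le> 1" using r \<epsilon> by (simp add: field_simps)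
  finally have du: "4 * real d * u \<le> 1" .
  have "10 ^ 7 * real k = (10 ^ 7 * (r / \<epsilon> ^ 5)) * (r / \<epsilon>) * \<epsilon> ^ 6"
    using \<epsilon> unfolding r(2)[symmetric] by (simp add: field_simps) (simp add: eval_nat_numeral)
  also have "\<dots> \<le> real n * real d * \<epsilon> ^ 6"
    using n d r \<epsilon> by (intro mult_right_mono mult_mono) auto
  finally have m: "10 ^ 7 * real k \<le> real (n * d) * \<epsilon> ^ 6" by simp
  have q: "12 * (real (n * d) * u) \<le> real q + 1" "real q \<le> 12 * (real (n * d) * u)"
    unfolding q_def using upos by (auto simp: of_nat_floor)
  have T: "is_tester Y (piecewise_class k (constant_functions Y)) (n + d) (min q (n + d)) \<epsilon>
      (band_tester n d q u (real (n * d) * u\<^sup>2 / 2 * (real k - 1 + real k * \<epsilon> / 8)))"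
    by (rule band_tester_correct[OF Y k \<epsilon> u_def du m q(1) refl])
  have s: "real (n + d) \<le> 2 * 10 ^ 7 * (sqrt (real k) / \<epsilon> ^ 5)"
    using n(2) d(2) re re5 unfolding r_def[symmetric] by simp
  have "real (min q (n + d)) \<le> 12 * (real (n * d) * u)" using q(2) by simp
  also have "\<dots> \<le> 12 * (((10 ^ 7 + 1) * (r / \<epsilon> ^ 5)) * (2 * (r / \<epsilon>)) * u)"
    using n d upos r \<epsilon> unfolding of_nat_mult by (intro mult_left_mono mult_right_mono mult_mono) auto
  also have "\<dots> = (12 * 2 * (10 ^ 7 + 1) / 64) * (1 / \<epsilon> ^ 4)"
    using r \<epsilon> unfolding u_def r(2)[symmetric] by (simp add: field_simps) (simp add: eval_nat_numeral)
  also have "\<dots> \<le> 2 * 10 ^ 7 * (1 / \<epsilon> ^ 4)" using \<epsilon> by (intro mult_right_mono) auto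
  finally have "real (min q (n + d)) \<le> 2 * 10 ^ 7 * (1 / \<epsilon> ^ 4)" .
  with T s that show thesis by simp
qed

section \<open>Random labelings of cells\<close>

text \<open>Cells are right-closed like the pieces of the class. Truncation at 0 by
  \<open>nat\<close> and the minimum with N - 1 put all points outside (0,1) into the first or last
  cell, which thereby extend to infinity like the outer pieces.\<close>

definition cell :: "nat \<Rightarrow> real \<Rightarrow> nat" where
  "cell N x = min (N - 1) (nat (\<lceil>real N * x\<rceil> - 1))"

lemma cell_less: "N \<ge> 1 \<Longrightarrow> cell N x < N"
  by (simp add: cell_def)

lemma cell_eq:
  assumes "j < N" "j = 0 \<or> real j < real N * x" "j = N - 1 \<or> real N * x \<le> real (Suc j)"
  shows "cell N x = j"
proof -
  have "j = 0 \<or> int j < \<lceil>real N * x\<rceil>" using assms(2) by (auto simp: less_ceiling_iff)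
  moreover have "j = N - 1 \<or> \<lceil>real N * x\<rceil> \<le> int (Suc j)" using assms(3) by (auto simp: ceiling_le_iff)
  ultimately show ?thesis using assms(1) unfolding cell_def by auto
qed

lemma cell_bounds:
  assumes "0 < x" "x < 1" "N \<ge> 1"
  shows "real (cell N x) < real N * x" "real N * x \<le> real (Suc (cell N x))"
proof -
  have "0 < real N * x" "real N * x \<le> real N" using assms by auto
  then have "1 \<le> \<lceil>real N * x\<rceil>" "\<lceil>real N * x\<rceil> \<le> int N" by (linarith, simp add: ceiling_le_iff)
  then have "int (cell N x) = \<lceil>real N * x\<rceil> - 1" unfolding cell_def by auto
  then show "real (cell N x) < real N * x" "real N * x \<le> real (Suc (cell N x))" by linarith+
qed

lemma cell_measurable [measurable]: "cell N \<in> borel \<rightarrow>\<^sub>M count_space UNIV"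
  unfolding cell_def by measurable

lemma emeasure_cell_le:
  assumes "N \<ge> 1"
  shows "emeasure unif01 {x. cell N x = j} \<le> ennreal (1 / real N)"
proof -
  have "{x. cell N x = j} \<in> sets borel"
    using measurable_sets[OF cell_measurable, of "{j}" N] by (simp add: vimage_def)
  then have "emeasure unif01 {x. cell N x = j} = emeasure lborel ({0<..<1} \<inter> {x. cell N x = j})"
    by (rule emeasure_unif01)
  also have "\<dots> \<le> emeasure lborel {real j / real N..real (Suc j) / real N}"
  proof (rule emeasure_mono)
    show "{0<..<1} \<inter> {x. cell N x = j} \<subseteq> {real j / real N..real (Suc j) / real N}"
      using cell_bounds[of _ N] assms by (force simp: field_simps)
  qed simp
  also have "\<dots> = ennreal (1 / real N)"
    using assms by (simp add: divide_right_mono flip: diff_divide_distrib)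
  finally show ?thesis .
qed

text \<open>Union bound over ordered pairs of different indices: once the first point is fixed,
  redrawing the second one hits the same cell with probability at most 1/N.\<close>

lemma cell_collision_le:
  fixes n N :: nat
  assumes N: "N \<ge> 1"
  defines "P \<equiv> \<Pi>\<^sub>M i\<in>{..<n}. unif01"
  defines "S \<equiv> {x \<in> space P. \<not> inj_on (\<lambda>i. cell N (x i)) {..<n}}"
  shows "S \<in> sets P" and "measure P S \<le> real n ^ 2 / real N"
proof -
  interpret P: prob_space P unfolding P_def by (rule prob_space_PiM[OF prob_space_unif01])
  define E where "E = {e \<in> {..<n} \<times> {..<n}. fst e \<noteq> snd e}"
  define C where "C e = {x \<in> space P. cell N (x (fst e)) = cell N (x (snd e))}" for e
  have C: "C e \<in> sets P" if "e \<in> E" for e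
  proof -
    have [measurable]: "(\<lambda>x. x (fst e)) \<in> P \<rightarrow>\<^sub>M borel" "(\<lambda>x. x (snd e)) \<in> P \<rightarrow>\<^sub>M borel"
      using that measurable_component_singleton[of _ "{..<n}" "\<lambda>_. unif01"]
      unfolding P_def E_def by (auto simp: measurable_cong_sets[OF refl sets_unif01])
    show ?thesis unfolding C_def by measurable
  qed
  have S: "S = (\<Union>e\<in>E. C e)"
    by (force simp: S_def C_def E_def inj_on_def)
  have fin: "finite E" by (simp add: E_def)
  show "S \<in> sets P" unfolding S using C fin by (intro sets.finite_UN) auto
  have Ce: "P.prob (C e) \<le> 1 / real N" if e: "e \<in> E" for e
  proof -
    let ?g = "indicator (C e) :: _ \<Rightarrow> ennreal"
    have "(\<integral>\<^sup>+x. 1 * ?g x \<partial>P) \<le> (\<integral>\<^sup>+x. 1 \<partial>P) * ennreal (1 / real N)"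
      unfolding P_def
    proof (rule nn_integral_PiM_resample_le[OF prob_space_unif01, where l = "snd e"])
      show "indicator (C e) \<in> borel_measurable (\<Pi>\<^sub>M i\<in>{..<n}. unif01)"
        using C[OF e] unfolding P_def by simp
      fix x assume x: "x \<in> space (\<Pi>\<^sub>M i\<in>{..<n}. unif01)"
      have "(\<integral>\<^sup>+y. ?g (x(snd e := y)) \<partial>unif01)
          = (\<integral>\<^sup>+y. indicator {y. cell N y = cell N (x (fst e))} y \<partial>unif01)"
        using x e by (intro nn_integral_cong)
          (auto simp: C_def P_def E_def space_PiM PiE_def extensional_def split: split_indicator)
      also have "\<dots> = emeasure unif01 {y. cell N y = cell N (x (fst e))}"
        using measurable_sets[OF cell_measurable, of "{cell N (x (fst e))}" N]
        by (intro nn_integral_indicator) (simp add: vimage_def)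
      finally show "(\<integral>\<^sup>+y. ?g (x(snd e := y)) \<partial>unif01) \<le> ennreal (1 / real N)"
        using emeasure_cell_le[OF N] by simp
    qed (use e in \<open>auto simp: E_def\<close>)
    then have "ennreal (P.prob (C e)) \<le> ennreal (1 / real N)"
      using C[OF e] by (simp add: P.emeasure_eq_measure P.prob_space)
    then show ?thesis by simp
  qed
  have "P.prob S \<le> (\<Sum>e\<in>E. P.prob (C e))"
    unfolding S using C fin by (intro P.finite_measure_subadditive_finite) auto
  also have "\<dots> \<le> (\<Sum>e\<in>E. 1 / real N)" by (intro sum_mono Ce)
  also have "\<dots> = real (card E) / real N" by simp
  also have "\<dots> \<le> real n ^ 2 / real N"
  proof (intro divide_right_mono)
    have "card E \<le> card ({..<n} \<times> {..<n})" by (intro card_mono) (auto simp: E_def)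
    then show "real (card E) \<le> real n ^ 2"
      by (metis card_cartesian_product card_lessThan of_nat_mono of_nat_power power2_eq_square)
  qed simp
  finally show "P.prob S \<le> real n ^ 2 / real N" .
qed

text \<open>Distinct cells carry independent fair bits, and the exclusive or with fixed bits \<beta>
  preserves uniformity: each observed pattern v comes from exactly 2^(N - n) labelings.\<close>

lemma sum_labelings_inj:
  fixes g :: "(nat \<Rightarrow> bool) \<Rightarrow> real" and c :: "nat \<Rightarrow> nat" and \<beta> :: "nat \<Rightarrow> bool"
  assumes inj: "inj_on c {..<n}" and c: "c ` {..<n} \<subseteq> {..<N}"
  shows "(\<Sum>\<tau>\<in>{..<N} \<rightarrow>\<^sub>E UNIV. g (\<lambda>i\<in>{..<n}. \<tau> (c i) \<noteq> \<beta> i)) / 2 ^ N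
    = (\<Sum>v\<in>{..<n} \<rightarrow>\<^sub>E UNIV. g v) / 2 ^ n"
proof -
  define \<phi> where "\<phi> \<tau> = (\<lambda>i\<in>{..<n}. \<tau> (c i) \<noteq> \<beta> i)" for \<tau> :: "nat \<Rightarrow> bool"
  let ?S = "{..<N} \<rightarrow>\<^sub>E (UNIV :: bool set)" and ?T = "{..<n} \<rightarrow>\<^sub>E (UNIV :: bool set)"
  have fin: "finite ?S" "finite ?T" by (auto intro: finite_PiE)
  have card: "card {\<tau> \<in> ?S. \<phi> \<tau> = v} = 2 ^ (N - n)" if v: "v \<in> ?T" for v
  proof -
    let ?inv = "the_inv_into {..<n} c"
    have "{\<tau> \<in> ?S. \<phi> \<tau> = v}
        = (\<Pi>\<^sub>E j\<in>{..<N}. if j \<in> c ` {..<n} then {v (?inv j) \<noteq> \<beta> (?inv j)} else UNIV)" (is "?L = ?R")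
    proof (intro set_eqI iffI)
      fix \<tau> assume \<tau>: "\<tau> \<in> ?L"
      have "\<tau> (c i) = (v i \<noteq> \<beta> i)" if "i < n" for i
      proof -
        have "\<phi> \<tau> i = v i" using \<tau> by simp
        then show ?thesis using that by (auto simp: \<phi>_def)
      qed
      then show "\<tau> \<in> ?R"
        using \<tau> by (auto simp: PiE_def Pi_def the_inv_into_f_f[OF inj])
    next
      fix \<tau> assume \<tau>: "\<tau> \<in> ?R"
      have "\<phi> \<tau> = v"
      proof
        fix i
        show "\<phi> \<tau> i = v i"
        proof (cases "i < n")
          case True
          then have "c i \<in> {..<N}" using c by auto
          then have "\<tau> (c i) = (v (?inv (c i)) \<noteq> \<beta> (?inv (c i)))"
            using \<tau> True by (fastforce dest!: PiE_mem[of _ _ _ "c i"])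
          then show ?thesis using True by (auto simp: \<phi>_def the_inv_into_f_f[OF inj])
        next
          case False
          then show ?thesis using v by (auto simp: \<phi>_def PiE_def extensional_def)
        qed
      qed
      then show "\<tau> \<in> ?L" using \<tau> by (auto simp: PiE_def)
    qed
    then have "card {\<tau> \<in> ?S. \<phi> \<tau> = v}
        = (\<Prod>j\<in>{..<N}. card (if j \<in> c ` {..<n} then {v (?inv j) \<noteq> \<beta> (?inv j)} else UNIV))"
      by (simp add: card_PiE)
    also have "\<dots> = (\<Prod>j\<in>{..<N}. if j \<in> c ` {..<n} then 1 else 2)"
      by (intro prod.cong) auto
    also have "\<dots> = 2 ^ card ({..<N} - c ` {..<n})"
      by (simp add: prod.If_cases Diff_eq Collect_neg_eq)
    also have "card ({..<N} - c ` {..<n}) = N - n"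
      using c inj by (subst card_Diff_subset) (auto simp: card_image)
    finally show ?thesis .
  qed
  have "n \<le> N" using card_mono[OF _ c] inj by (simp add: card_image)
  have "(\<Sum>\<tau>\<in>?S. g (\<phi> \<tau>)) = (\<Sum>v\<in>?T. \<Sum>\<tau>\<in>{\<tau> \<in> ?S. \<phi> \<tau> = v}. g (\<phi> \<tau>))"
  proof -
    have "\<phi> ` ?S \<subseteq> ?T" by (intro image_subsetI) (simp add: \<phi>_def restrict_PiE_iff)
    from sum.group[OF fin this, of "\<lambda>\<tau>. g (\<phi> \<tau>)"] show ?thesis by (rule sym)
  qed
  also have "\<dots> = (\<Sum>v\<in>?T. 2 ^ (N - n) * g v)"
    by (intro sum.cong refl) (simp add: card)
  also have "\<dots> = 2 ^ (N - n) * (\<Sum>v\<in>?T. g v)" by (simp add: sum_distrib_left)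
  finally show ?thesis using \<open>n \<le> N\<close> unfolding \<phi>_def by (simp add: power_diff)
qed

text \<open>One formula for both families; the inequality of truth values is an exclusive or.
  Constant \<beta> gives functions constant on cells, \<open>second_half\<close> exchanges the two
  labels in the right half of each cell.\<close>

definition cell_labeling :: "'y \<Rightarrow> 'y \<Rightarrow> nat \<Rightarrow> (real \<Rightarrow> bool) \<Rightarrow> (nat \<Rightarrow> bool) \<Rightarrow> real \<Rightarrow> 'y" where
  "cell_labeling a b N \<beta> \<tau> x = (if \<tau> (cell N x) \<noteq> \<beta> x then a else b)"

definition second_half :: "nat \<Rightarrow> real \<Rightarrow> bool" where
  "second_half N x \<longleftrightarrow> real (cell N x) + 1 / 2 < real N * x"

lemma cell_labeling_measurable:
  assumes "a \<in> space Y" "b \<in> space Y" and [measurable]: "Measurable.pred borel \<beta>"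
  shows "cell_labeling a b N \<beta> \<tau> \<in> borel \<rightarrow>\<^sub>M Y"
proof -
  have [measurable]: "Measurable.pred borel (\<lambda>x. \<tau> (cell N x))"
    by (rule measurable_compose[OF cell_measurable]) simp
  show ?thesis
    unfolding cell_labeling_def using assms(1,2) by (intro measurable_If) auto
qed

lemma cell_labeling_piecewise:
  assumes ab: "a \<in> space Y" "b \<in> space Y" and k: "k \<ge> 1"
  shows "cell_labeling a b k (\<lambda>_. False) \<tau> \<in> piecewise_class k (constant_functions Y)"
proof -
  \<comment> \<open>Only the inner cell borders are cuts; the infinite outer cuts agree with the
    clamping in \<open>cell\<close>.\<close>
  define t where "t i = (if i = 0 then - \<infinity> else if i < k then ereal (real i / real k) else \<infinity>)" for i
  define h where "h i = (\<lambda>_ :: real. if \<tau> (i - 1) then a else b)" for i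
  show ?thesis
  proof (rule piecewise_classI[of t _ h])
    show "t 0 = - \<infinity>" "t k = \<infinity>" using k by (auto simp: t_def)
    show "\<bar>t i\<bar> \<noteq> \<infinity>" if "i \<in> {1..<k}" for i using that by (auto simp: t_def)
    show "t i \<le> t j" if "i \<in> {1..<k}" "j \<in> {1..<k}" "i \<le> j" for i j
      using that by (auto simp: t_def divide_right_mono)
    show "h i \<in> constant_functions Y" if "i \<in> {1..k}" for i
      using ab by (auto simp: h_def constant_functions_def)
    fix x i assume i: "i \<in> {1..k}" and x: "t (i - 1) < ereal x" "ereal x \<le> t i"
    have "cell k x = i - 1"
    proof (rule cell_eq)
      show "i - 1 < k" using i by auto
      show "i - 1 = 0 \<or> real (i - 1) < real k * x"
        using x(1) i k by (cases "i = 1") (auto simp: t_def field_simps split: if_splits)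
      show "i - 1 = k - 1 \<or> real k * x \<le> real (Suc (i - 1))"
        using x(2) i k by (cases "i = k") (auto simp: t_def field_simps split: if_splits)
    qed
    then show "cell_labeling a b k (\<lambda>_. False) \<tau> x = h i x"
      by (simp add: cell_labeling_def h_def)
  qed
qed

text \<open>The k - 1 breakpoints of g leave at least k of the 2 k cells untouched. On such a cell g
  is constant while f takes both labels on the two halves, so g errs on a half of mass 1/(4
  k).\<close>

lemma cell_labeling_far:
  fixes \<tau> :: "nat \<Rightarrow> bool"
  assumes Y: "disagreement_measurable Y" and ab: "a \<in> space Y" "b \<in> space Y" "a \<noteq> b" and k: "k \<ge> 1"
  defines "f \<equiv> cell_labeling a b (2 * k) (second_half (2 * k)) \<tau>"
  shows "1 / 4 \<le> class_dist f (piecewise_class k (constant_functions Y))"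
  unfolding class_dist_def
proof (rule cINF_greatest)
  show "piecewise_class k (constant_functions Y) \<noteq> {}"
    using cell_labeling_piecewise[OF ab(1,2) k] by blast
  fix g assume g: "g \<in> piecewise_class k (constant_functions Y)"
  define N where "N = 2 * k"
  have N: "N \<ge> 1" "0 < real N" using k by (simp_all add: N_def)
  obtain r where r: "\<And>x y. x \<le> y \<Longrightarrow> g x \<noteq> g y \<Longrightarrow> \<exists>i\<in>{1..<k}. x \<le> r i \<and> r i < y"
    by (rule piecewise_breakpoints[OF g]) blast
  define L where "L j = {real j / real N<..<(real j + 1 / 2) / real N}" for j
  define U where "U j = {(real j + 1 / 2) / real N<..<real (Suc j) / real N}" for j
  define G where "G = {..<N} - (\<lambda>i. cell N (r i)) ` {1..<k}"
  \<comment> \<open>A half of cell j on which g is wrong, judged by the value of g at the right end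
    of the cell, which belongs to the cell. The left half of the cell carries the label chosen by
    \<open>\<tau> j\<close>.\<close>
  define H where "H j = (if g (real (Suc j) / real N) = (if \<tau> j then a else b) then U j else L j)" for j
  have cellI: "cell N x = j" if "j < N" "real j / real N < x" "x \<le> real (Suc j) / real N" for j x
    using that N by (intro cell_eq) (auto simp: field_simps)
  have gconst: "g x = g (real (Suc j) / real N)"
    if j: "j \<in> G" and x: "real j / real N < x" "x \<le> real (Suc j) / real N" for j x
  proof (rule ccontr)
    assume "\<not> ?thesis"
    then obtain i where i: "i \<in> {1..<k}" "x \<le> r i" "r i < real (Suc j) / real N"
      using r[OF x(2)] by blast
    then have "cell N (r i) = j" using j x by (intro cellI) (auto simp: G_def)
    then show False using j i(1) by (auto simp: G_def)
  qed
  have LU: "L j \<subseteq> {real j / real N<..<real (Suc j) / real N}" "U j \<subseteq> {real j / real N<..<real (Suc j) / real N}" for j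
    using N by (auto simp: L_def U_def field_simps)
  then have Hsub: "H j \<subseteq> {real j / real N<..<real (Suc j) / real N}" for j by (simp add: H_def)
  have fm: "f \<in> borel \<rightarrow>\<^sub>M Y"
    unfolding f_def by (intro cell_labeling_measurable ab) (unfold second_half_def, measurable)
  have D: "{x. f x \<noteq> g x} \<in> sets borel"
    using Y[unfolded disagreement_measurable_def, rule_format] fm piecewise_class_measurable[OF g] by simp
  have HD: "H j \<subseteq> {x. f x \<noteq> g x}" if j: "j \<in> G" for j
  proof
    fix x assume x: "x \<in> H j"
    then have b: "real j / real N < x" "x < real (Suc j) / real N"
      using subsetD[OF Hsub] by auto
    have c: "cell N x = j" using b j by (intro cellI) (auto simp: G_def)
    have "g x = g (real (Suc j) / real N)" using gconst[OF j b(1)] b(2) by simp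
    moreover have "second_half N x \<longleftrightarrow> x \<in> U j" if "x \<in> U j \<or> x \<in> L j"
      using that N b c by (auto simp: second_half_def L_def U_def field_simps)
    moreover have "L j \<inter> U j = {}" by (auto simp: L_def U_def)
    ultimately show "x \<in> {x. f x \<noteq> g x}"
      using x ab(3) c by (auto simp: f_def cell_labeling_def N_def[symmetric] H_def split: if_splits)
  qed
  have HU: "H j \<subseteq> {0<..<1}" if "j \<in> G" for j
  proof -
    have "real (Suc j) \<le> real N" using that by (auto simp: G_def)
    then have "real (Suc j) / real N \<le> 1" using N by simp
    moreover have "0 \<le> real j / real N" by simp
    ultimately have "{real j / real N<..<real (Suc j) / real N} \<subseteq> {0<..<1}"
      by (intro subsetI) (simp only: greaterThanLessThan_iff, linarith)
    then show ?thesis using Hsub[of j] by blast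
  qed
  have Hs [measurable]: "H j \<in> sets borel" for j by (simp add: H_def L_def U_def)
  have Hm: "measure unif01 (H j) = 1 / (2 * real N)" if j: "j \<in> G" for j
  proof -
    have "emeasure unif01 (H j) = emeasure lborel (H j)"
      using HU[OF j] by (subst emeasure_unif01) (auto simp: Int_absorb1)
    also have "\<dots> = ennreal (1 / (2 * real N))"
    proof -
      have "emeasure lborel {c / real N<..<(c + 1 / 2) / real N} = ennreal (1 / (2 * real N))" for c
        using N by (simp add: divide_right_mono flip: diff_divide_distrib)
      from this[of "real j"] this[of "real j + 1 / 2"] show ?thesis
        by (simp add: H_def L_def U_def add.assoc add.commute[of 1])
    qed
    finally show ?thesis by (simp add: measure_def)
  qed
  have disj: "disjoint_family_on H G"
    unfolding disjoint_family_on_def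
  proof (intro ballI impI)
    fix i j assume "i \<in> G" "j \<in> G" "i \<noteq> j"
    have "cell N x = j" if "x \<in> H j" "j \<in> G" for x j
      using subsetD[OF Hsub that(1)] that(2) by (intro cellI) (auto simp: G_def)
    with \<open>i \<in> G\<close> \<open>j \<in> G\<close> \<open>i \<noteq> j\<close> show "H i \<inter> H j = {}" by blast
  qed
  have "real k \<le> real (card G)"
  proof -
    have "card ((\<lambda>i. cell N (r i)) ` {1..<k}) \<le> k - 1"
      using card_image_le[of "{1..<k}" "\<lambda>i. cell N (r i)"] by simp
    moreover have "N - card ((\<lambda>i. cell N (r i)) ` {1..<k}) \<le> card G"
      unfolding G_def using diff_card_le_card_Diff[of "(\<lambda>i. cell N (r i)) ` {1..<k}" "{..<N}"] by simp
    ultimately show ?thesis unfolding N_def by simp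
  qed
  then have "1 / 4 \<le> real (card G) * (1 / (2 * real N))"
    using k by (simp add: N_def field_simps)
  also have "\<dots> = (\<Sum>j\<in>G. measure unif01 (H j))" by (simp add: Hm)
  also have "\<dots> = measure unif01 (\<Union>j\<in>G. H j)"
    using disj by (intro unif01.finite_measure_finite_Union[symmetric]) (auto simp: G_def)
  also have "\<dots> \<le> fdist f g"
    unfolding fdist_def using HD D by (intro unif01.finite_measure_mono) auto
  finally show "1 / 4 \<le> fdist f g" .
qed

section \<open>The lower bound on the sample size\<close>

lemma verdict_cong:
  assumes "\<And>i. i \<in> queried t v \<Longrightarrow> v i = w i"
  shows "verdict t v = verdict t w"
  using assms by (induction t) auto

text \<open>The point is that the right-hand side mentions neither N nor \<beta>: on a
  collision-free sample both families of labelings are accepted equally often on average.\<close>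

lemma accept_average_inj:
  fixes a b :: 'y and N n :: nat and \<beta> :: "real \<Rightarrow> bool"
  assumes tester: "is_tester Y F s q \<epsilon> A" and n: "n = sample_size A" and N: "N \<ge> 1"
    and meas: "\<And>\<tau>. cell_labeling a b N \<beta> \<tau> \<in> borel \<rightarrow>\<^sub>M Y"
    and rx: "(r, x) \<in> space (run_space A)" and inj: "inj_on (\<lambda>i. cell N (x i)) {..<n}"
  shows "(\<Sum>\<tau>\<in>{..<N} \<rightarrow>\<^sub>E UNIV. indicator (accept_event A (cell_labeling a b N \<beta> \<tau>)) (r, x)) / 2 ^ N
    = (\<Sum>v\<in>{..<n} \<rightarrow>\<^sub>E UNIV. of_bool (verdict (strategy A r x) (\<lambda>i. if v i then a else b))) / (2 ^ n :: real)"
proof -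
  define g where "g v = (of_bool (verdict (strategy A r x) (\<lambda>i. if v i then a else b)) :: real)" for v
  have eq: "indicator (accept_event A (cell_labeling a b N \<beta> \<tau>)) (r, x)
      = g (\<lambda>i\<in>{..<n}. \<tau> (cell N (x i)) \<noteq> \<beta> (x i))" for \<tau>
  proof -
    let ?f = "cell_labeling a b N \<beta> \<tau>"
    have "queried (strategy A r x) (\<lambda>i. ?f (x i)) \<subseteq> {..<n}"
      using tester meas[of \<tau>] rx unfolding is_tester_def n by blast
    then have "verdict (strategy A r x) (\<lambda>i. ?f (x i))
        = verdict (strategy A r x) (\<lambda>i. if (\<lambda>i\<in>{..<n}. \<tau> (cell N (x i)) \<noteq> \<beta> (x i)) i then a else b)"
      by (intro verdict_cong) (auto simp: cell_labeling_def)
    then show ?thesis using rx by (simp add: g_def accept_event_def indicator_def)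
  qed
  have "(\<lambda>i. cell N (x i)) ` {..<n} \<subseteq> {..<N}" using N by (auto simp: cell_less)
  from sum_labelings_inj[OF inj this, of g "\<lambda>i. \<beta> (x i)"] show ?thesis
    unfolding eq by (simp only: g_def)
qed

text \<open>The average acceptance probability is at least 2/3 over the first family and at most 1/3
  over the second. The difference comes from samples with a collision among k or 2 k cells, so 1/3
  \<le> n^2/k + n^2/(2 k), which is more than enough for n \<ge> \<surd>k/4.\<close>

lemma tester_sample_size_ge:
  assumes Y: "disagreement_measurable Y" and ab: "a \<in> space Y" "b \<in> space Y" "a \<noteq> b"
    and k: "k \<ge> 1" and \<epsilon>: "\<epsilon> \<le> 1 / 4"
    and tester: "is_tester Y (piecewise_class k (constant_functions Y)) s q \<epsilon> A"
  shows "1 / 4 * sqrt (real k) \<le> real s"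
proof -
  define n where "n = sample_size A"
  define P where "P = (\<Pi>\<^sub>M i\<in>{..<n}. unif01)"
  let ?R = "run_space A"
  let ?yes = "\<lambda>\<tau>. cell_labeling a b k (\<lambda>_. False) \<tau>"
  let ?no = "\<lambda>\<tau>. cell_labeling a b (2 * k) (second_half (2 * k)) \<tau>"
  have coins: "prob_space (coins A)" and ns: "n \<le> s" using tester by (auto simp: is_tester_def n_def)
  interpret coins: prob_space "coins A" by fact
  interpret P: prob_space P unfolding P_def by (rule prob_space_PiM[OF prob_space_unif01])
  interpret CP: pair_prob_space "coins A" P ..
  interpret R: prob_space ?R
    unfolding run_space_def n_def[symmetric] P_def[symmetric] by unfold_locales
  have yes_meas: "?yes \<tau> \<in> borel \<rightarrow>\<^sub>M Y" for \<tau>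
    by (intro cell_labeling_measurable ab) simp
  have no_meas: "?no \<tau> \<in> borel \<rightarrow>\<^sub>M Y" for \<tau>
    by (intro cell_labeling_measurable ab) (unfold second_half_def, measurable)
  have yes_sets: "accept_event A (?yes \<tau>) \<in> sets ?R" and no_sets: "accept_event A (?no \<tau>) \<in> sets ?R" for \<tau>
    using tester yes_meas no_meas unfolding is_tester_def by blast+
  have yes: "2 / 3 \<le> R.prob (accept_event A (?yes \<tau>))" for \<tau>
    using tester yes_meas cell_labeling_piecewise[OF ab(1,2) k] unfolding is_tester_def by blast
  have no: "R.prob (accept_event A (?no \<tau>)) \<le> 1 / 3" for \<tau>
  proof -
    have "\<epsilon> \<le> class_dist (?no \<tau>) (piecewise_class k (constant_functions Y))"
      using cell_labeling_far[OF Y ab k, of \<tau>] \<epsilon> by linarith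
    then have "2 / 3 \<le> R.prob (reject_event A (?no \<tau>))"
      using tester no_meas[of \<tau>] unfolding is_tester_def by blast
    moreover have "reject_event A (?no \<tau>) = space ?R - accept_event A (?no \<tau>)"
      by (auto simp: accept_event_def reject_event_def)
    ultimately show ?thesis using R.prob_compl[OF no_sets[of \<tau>]] by simp
  qed
  define S where "S N = {x \<in> space P. \<not> inj_on (\<lambda>i. cell N (x i)) {..<n}}" for N
  define C where "C N = space (coins A) \<times> S N" for N
  have C: "C N \<in> sets ?R" "R.prob (C N) \<le> real n ^ 2 / real N" if "N \<ge> 1" for N
  proof -
    note S = cell_collision_le[OF that, of n, folded P_def, folded S_def]
    show "C N \<in> sets ?R" "R.prob (C N) \<le> real n ^ 2 / real N"
      using measure_run_space[OF coins, folded n_def, folded P_def, OF S(1)] S(2) by (simp_all add: C_def)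
  qed
  have k2: "2 * k \<ge> 1" using k by simp
  let ?avg_yes = "\<lambda>z. (\<Sum>\<tau>\<in>{..<k} \<rightarrow>\<^sub>E UNIV. indicator (accept_event A (?yes \<tau>)) z) / 2 ^ k :: real"
  let ?avg_no = "\<lambda>z. (\<Sum>\<tau>\<in>{..<2 * k} \<rightarrow>\<^sub>E UNIV. indicator (accept_event A (?no \<tau>)) z) / 2 ^ (2 * k) :: real"
  have card: "card ({..<N} \<rightarrow>\<^sub>E (UNIV :: bool set)) = 2 ^ N" for N by (simp add: card_PiE)
  \<comment> \<open>The comparison is made for each outcome of coins and sample: equality without
    collisions, and with a collision an indicator pays for the trivial bound 1.\<close>
  have le: "?avg_yes z \<le> ?avg_no z + indicator (C k) z + indicator (C (2 * k)) z" if z: "z \<in> space ?R" for z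
  proof (cases "z \<in> C k \<union> C (2 * k)")
    case True
    have "(\<Sum>\<tau>\<in>{..<k} \<rightarrow>\<^sub>E UNIV. indicator (accept_event A (?yes \<tau>)) z) \<le> (\<Sum>\<tau>\<in>{..<k} \<rightarrow>\<^sub>E (UNIV :: bool set). 1 :: real)"
      by (intro sum_mono) (auto split: split_indicator)
    then have "?avg_yes z \<le> 1" by (simp add: card)
    moreover have "0 \<le> ?avg_no z" by (intro divide_nonneg_nonneg sum_nonneg) auto
    moreover have "1 \<le> indicator (C k) z + (indicator (C (2 * k)) z :: real)"
      using True by (auto split: split_indicator)
    ultimately show ?thesis by linarith
  next
    case False
    obtain r x where z': "z = (r, x)" by (cases z)
    have "x \<in> space P" "r \<in> space (coins A)"
      using z unfolding z' run_space_def n_def[symmetric] P_def[symmetric] by (auto simp: space_pair_measure)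
    then have inj: "inj_on (\<lambda>i. cell k (x i)) {..<n}" "inj_on (\<lambda>i. cell (2 * k) (x i)) {..<n}"
      using False by (auto simp: z' C_def S_def)
    have "?avg_yes z = ?avg_no z"
      using accept_average_inj[OF tester n_def k yes_meas z[unfolded z'] inj(1)]
        accept_average_inj[OF tester n_def k2 no_meas z[unfolded z'] inj(2)] unfolding z' by simp
    then show ?thesis by simp
  qed
  have int: "integrable ?R (indicator D :: _ \<Rightarrow> real)" if "D \<in> sets ?R" for D
    using that by (simp add: R.emeasure_eq_measure)
  have "2 / 3 = (\<Sum>\<tau>\<in>{..<k} \<rightarrow>\<^sub>E (UNIV :: bool set). 2 / 3) / (2 ^ k :: real)" by (simp add: card)
  also have "\<dots> \<le> (\<Sum>\<tau>\<in>{..<k} \<rightarrow>\<^sub>E UNIV. R.prob (accept_event A (?yes \<tau>))) / 2 ^ k"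
    by (intro divide_right_mono sum_mono yes) simp
  also have "\<dots> = (\<integral>z. ?avg_yes z \<partial>?R)"
    using yes_sets by (simp add: int Bochner_Integration.integral_sum)
  also have "\<dots> \<le> (\<integral>z. ?avg_no z + indicator (C k) z + indicator (C (2 * k)) z \<partial>?R)"
    using yes_sets no_sets C(1)[OF k] C(1)[OF k2]
    by (intro integral_mono le Bochner_Integration.integrable_add integrable_divide Bochner_Integration.integrable_sum int)
  also have "\<dots> = (\<Sum>\<tau>\<in>{..<2 * k} \<rightarrow>\<^sub>E UNIV. R.prob (accept_event A (?no \<tau>))) / 2 ^ (2 * k)
      + R.prob (C k) + R.prob (C (2 * k))"
    using no_sets C(1)[OF k] C(1)[OF k2] by (simp add: int Bochner_Integration.integral_sum)
  also have "\<dots> \<le> (\<Sum>\<tau>\<in>{..<2 * k} \<rightarrow>\<^sub>E (UNIV :: bool set). 1 / 3) / 2 ^ (2 * k)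
      + real n ^ 2 / real k + real n ^ 2 / real (2 * k)"
    by (intro add_mono divide_right_mono sum_mono no C(2) k k2) simp
  also have "\<dots> = 1 / 3 + 3 / 2 * (real n ^ 2 / real k)" by (simp add: card)
  finally have "1 / 16 * real k \<le> real n ^ 2" using k by (simp add: field_simps)
  then have "(1 / 4 * sqrt (real k))\<^sup>2 \<le> (real n)\<^sup>2" by (simp add: power_mult_distrib power_divide)
  then have "1 / 4 * sqrt (real k) \<le> real n" by (rule power2_le_imp_le) simp
  then show ?thesis using ns by linarith
qed

lemma is_tester_mono_queries:
  assumes "is_tester Y F s q \<epsilon> A" "q \<le> q'"
  shows "is_tester Y F s q' \<epsilon> A"
  using assms unfolding is_tester_def by fastforce

theorem theorem2:
  "(\<exists>C > 0. \<forall>(Y :: 'y measure) (k :: nat) (\<epsilon> :: real).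
      disagreement_measurable Y \<longrightarrow> (\<exists>a\<in>space Y. \<exists>b\<in>space Y. a \<noteq> b) \<longrightarrow>
      k \<ge> 1 \<longrightarrow> 0 < \<epsilon> \<longrightarrow> \<epsilon> < 1 / 2 \<longrightarrow>
        (\<exists>s q A. is_tester Y (piecewise_class k (constant_functions Y)) s q \<epsilon> A \<and> q \<le> s \<and>
           real s \<le> C * (sqrt (real k) / \<epsilon> ^ 5) \<and> real q \<le> C * (1 / \<epsilon> ^ 4)) \<and>
        (\<exists>s A. is_tester Y (piecewise_class k (constant_functions Y)) s s \<epsilon> A \<and>
           real s \<le> C * (sqrt (real k) / \<epsilon> ^ 5))) \<and>
   (\<exists>c > 0. \<forall>(Y :: 'y measure) (k :: nat) (\<epsilon> :: real) (s :: nat) A.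
      disagreement_measurable Y \<longrightarrow> (\<exists>a\<in>space Y. \<exists>b\<in>space Y. a \<noteq> b) \<longrightarrow>
      k \<ge> 1 \<longrightarrow> 0 < \<epsilon> \<longrightarrow> \<epsilon> < 1 / 8 \<longrightarrow>
      is_tester Y (piecewise_class k (constant_functions Y)) s s \<epsilon> A \<longrightarrow>
        real s \<ge> c * sqrt (real k))"
proof (rule conjI)
  show "\<exists>C > 0. \<forall>(Y :: 'y measure) (k :: nat) (\<epsilon> :: real).
      disagreement_measurable Y \<longrightarrow> (\<exists>a\<in>space Y. \<exists>b\<in>space Y. a \<noteq> b) \<longrightarrow>
      k \<ge> 1 \<longrightarrow> 0 < \<epsilon> \<longrightarrow> \<epsilon> < 1 / 2 \<longrightarrow>
        (\<exists>s q A. is_tester Y (piecewise_class k (constant_functions Y)) s q \<epsilon> A \<and> q \<le> s \<and>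
           real s \<le> C * (sqrt (real k) / \<epsilon> ^ 5) \<and> real q \<le> C * (1 / \<epsilon> ^ 4)) \<and>
        (\<exists>s A. is_tester Y (piecewise_class k (constant_functions Y)) s s \<epsilon> A \<and>
           real s \<le> C * (sqrt (real k) / \<epsilon> ^ 5))"
  proof (rule exI[of _ "2 * 10 ^ 7"], intro conjI allI impI)
    fix Y :: "'y measure" and k :: nat and \<epsilon> :: real
    assume "disagreement_measurable Y" "k \<ge> 1" "0 < \<epsilon>" "\<epsilon> < 1 / 2"
    then obtain s q and A :: "'y algorithm"
      where A: "is_tester Y (piecewise_class k (constant_functions Y)) s q \<epsilon> A" "q \<le> s"
        "real s \<le> 2 * 10 ^ 7 * (sqrt (real k) / \<epsilon> ^ 5)" "real q \<le> 2 * 10 ^ 7 * (1 / \<epsilon> ^ 4)"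
      by (rule piecewise_tester_exists)
    then show "\<exists>s q A. is_tester Y (piecewise_class k (constant_functions Y)) s q \<epsilon> A \<and> q \<le> s \<and>
        real s \<le> 2 * 10 ^ 7 * (sqrt (real k) / \<epsilon> ^ 5) \<and> real q \<le> 2 * 10 ^ 7 * (1 / \<epsilon> ^ 4)"
      by blast
    show "\<exists>s A. is_tester Y (piecewise_class k (constant_functions Y)) s s \<epsilon> A \<and>
        real s \<le> 2 * 10 ^ 7 * (sqrt (real k) / \<epsilon> ^ 5)"
      \<comment> \<open>The passive tester is the same algorithm with the query budget raised from q
        to s.\<close>
      using is_tester_mono_queries[OF A(1,2)] A(3) by blast
  qed simp
  show "\<exists>c > 0. \<forall>(Y :: 'y measure) (k :: nat) (\<epsilon> :: real) (s :: nat) A.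
      disagreement_measurable Y \<longrightarrow> (\<exists>a\<in>space Y. \<exists>b\<in>space Y. a \<noteq> b) \<longrightarrow>
      k \<ge> 1 \<longrightarrow> 0 < \<epsilon> \<longrightarrow> \<epsilon> < 1 / 8 \<longrightarrow>
      is_tester Y (piecewise_class k (constant_functions Y)) s s \<epsilon> A \<longrightarrow>
        real s \<ge> c * sqrt (real k)"
  proof (rule exI[of _ "1 / 4"], intro conjI allI impI)
    fix Y :: "'y measure" and k s :: nat and \<epsilon> :: real and A :: "'y algorithm"
    assume Y: "disagreement_measurable Y" and ab: "\<exists>a\<in>space Y. \<exists>b\<in>space Y. a \<noteq> b"
      and k: "k \<ge> 1" and \<epsilon>: "\<epsilon> < 1 / 8"
      and A: "is_tester Y (piecewise_class k (constant_functions Y)) s s \<epsilon> A"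
    from ab obtain a b where "a \<in> space Y" "b \<in> space Y" "a \<noteq> b" by blast
    from tester_sample_size_ge[OF Y this k _ A] \<epsilon> show "1 / 4 * sqrt (real k) \<le> real s" by simp
  qed simp
qed

end
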